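(* Let $s_0\in(0,1]$. If $\dim\ker N_{s_0}=1$, with $\ker N_{s_0}$ spanned by $\mathbf u_{s_0}$, then for real $|\lambda|\ll1$ there exists a $C^2$ curve $s(\lambda)$ such that $s(\lambda)^2\lambda\in\operatorname{Spec}(N_{s(\lambda)})$, and a continuous curve $\mathbf u_{s(\lambda)}$ of eigenfunctions (of $N_{s(\lambda)}$ for the eigenvalue $s(\lambda)^2\lambda$) such that $\mathbf u_{s(\lambda)}\to\mathbf u_{s_0}$ as $\lambda\to0$. Moreover $s(0)=s_0$, $\dot s(0)=0$, and the concavity of $s(\lambda)$ is determined as follows (dot denotes $d/d\lambda$): (1) If $0\in\operatorname{Spec}(L_-^{s_0})\setminus\operatorname{Spec}(L_+^{s_0})$ with eigenfunction $v_{s_0}\in\ker L_-^{s_0}$, then $$\ddot s(0)=\frac{2s_0^5}{\ell}\,\frac{\langle\widehat u_{s_0},v_{s_0}\rangle}{(v_{s_0}'(\ell))^2},$$ where $\widehat u_{s_0}\in H^2(0,\ell)\cap H^1_0(0,\ell)$ is the unique solution to $L_+^{s_0}\widehat u_{s_0}=v_{s_0}$. (2) If $0\in\operatorname{Spec}(L_+^{s_0})\setminus\operatorname{Spec}(L_-^{s_0})$ with eigenfunction $u_{s_0}\in\ker L_+^{s_0}$, then $$\ddot s(0)=-\frac{2s_0^5}{\ell}\,\frac{\langle\widehat v_{s_0},u_{s_0}\rangle}{(u_{s_0}'(\ell))^2},$$ where $\widehat v_{s_0}\in H^2(0,\ell)\cap H^1_0(0,\ell)$ is the unique solution to $-L_-^{s_0}\widehat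 v_{s_0}=u_{s_0}$.
   Context: $\ell>0$ and $g,h$ are real-valued $C^2$ functions on $[0,\ell]$ (when $s>1$ occurs, i.e. for $s_0=1$, taken to be defined and $C^2$ on $[0,\ell']$ for some $\ell'>\ell$). Put $L_+^s=-\partial_{xx}-s^2g(sx)$, $L_-^s=-\partial_{xx}-s^2h(sx)$, unbounded operators in $L^2(0,\ell)$ with domain $H^2(0,\ell)\cap H^1_0(0,\ell)$, and $N_s=\begin{pmatrix}0&-L_-^s\\L_+^s&0\end{pmatrix}$ in $L^2(0,\ell)^2$ with domain $(H^2(0,\ell)\cap H^1_0(0,\ell))^2$. $\langle\cdot,\cdot\rangle$ is the $L^2(0,\ell)$ inner product; eigenfunctions are real-valued. *)

theory Defs
  imports "HOL-Analysis.Analysis"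
begin

text \<open>
  Derivatives are taken within the set, i.e. they are one-sided at the endpoints of a closed
  interval and ordinary ones on an open set.
\<close>

definition C2_on :: "real set \<Rightarrow> (real \<Rightarrow> real) \<Rightarrow> bool" where
  "C2_on S f \<longleftrightarrow> (\<exists>f' f''.
     (\<forall>x\<in>S. (f has_real_derivative f' x) (at x within S)) \<and>
     (\<forall>x\<in>S. (f' has_real_derivative f'' x) (at x within S)) \<and>
     continuous_on S f'')"


text \<open>
  Elements of \<open>L\<^sup>2(0,l)\<close> are represented by functions on the real line, of which only the
  restriction to the open interval matters, and they are identified by \<open>ae_eq\<close> instead of forming
  the quotient. The codomain is \<open>real\<close> for \<open>L\<^sup>2(0,l)\<close> and \<open>real \<times> real\<close> for
  \<open>L\<^sup>2(0,l)\<^sup>2\<close>; the norm of \<open>real \<times> real\<close> is the Euclidean one, so that \<open>L2_norm\<close>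
  is the norm of the Hilbert space direct sum.
\<close>

definition L2 :: "real \<Rightarrow> (real \<Rightarrow> 'a::euclidean_space) set" where
  "L2 l = {f \<in> borel_measurable (lebesgue_on {0<..<l}).
             integrable (lebesgue_on {0<..<l}) (\<lambda>x. (norm (f x))\<^sup>2)}"

definition L2_norm :: "real \<Rightarrow> (real \<Rightarrow> 'a::euclidean_space) \<Rightarrow> real" where
  "L2_norm l f = sqrt (integral\<^sup>L (lebesgue_on {0<..<l}) (\<lambda>x. (norm (f x))\<^sup>2))"

definition L2_inner :: "real \<Rightarrow> (real \<Rightarrow> real) \<Rightarrow> (real \<Rightarrow> real) \<Rightarrow> real" where
  "L2_inner l f g = integral\<^sup>L (lebesgue_on {0<..<l}) (\<lambda>x. f x * g x)"

definition ae_eq :: "real \<Rightarrow> (real \<Rightarrow> 'a::euclidean_space) \<Rightarrow> (real \<Rightarrow> 'a) \<Rightarrow> bool" where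
  "ae_eq l f g \<longleftrightarrow> (AE x in lebesgue_on {0<..<l}. f x = g x)"


text \<open>
  Sobolev spaces on an interval, as spaces of absolutely continuous functions:
  \<open>H1_deriv l u u'\<close> says that \<open>u\<close> is on the closed interval an indefinite integral of the
  square integrable function \<open>u'\<close>, i.e. that \<open>u\<close> is the absolutely continuous representative
  of an element of \<open>H\<^sup>1(0,l)\<close> with weak derivative \<open>u'\<close>. Members of these spaces
  therefore have well-defined values at the endpoints, and members of \<open>H2\<close> are continuously
  differentiable up to the endpoints. Note that \<open>u'\<close> is determined only almost everywhere by
  \<open>H1_deriv l u u'\<close> alone, but in \<open>H2\<close> it is the absolutely continuous one.
\<close>

definition H1_deriv :: "real \<Rightarrow> (real \<Rightarrow> real) \<Rightarrow> (real \<Rightarrow> real) \<Rightarrow> bool" where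
  "H1_deriv l u u' \<longleftrightarrow>
     u' \<in> L2 l \<and> (\<forall>x\<in>{0..l}. (u' has_integral (u x - u 0)) {0..x})"

definition H2 :: "real \<Rightarrow> (real \<Rightarrow> real) set" where
  "H2 l = {u. \<exists>u' u''. H1_deriv l u u' \<and> H1_deriv l u' u''}"

definition H10 :: "real \<Rightarrow> (real \<Rightarrow> real) set" where
  "H10 l = {u. (\<exists>u'. H1_deriv l u u') \<and> u 0 = 0 \<and> u l = 0}"


text \<open>
  Unbounded operators are given by their graphs; \<open>(u, f) \<in> T\<close> reads: \<open>u\<close> is in the domain
  of \<open>T\<close> and \<open>T u = f\<close>, where \<open>f\<close> ranges over all representatives of the value.
\<close>

type_synonym 'a oper = "((real \<Rightarrow> 'a) \<times> (real \<Rightarrow> 'a)) set"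

text \<open>
  The operator \<open>- d\<^sup>2/dx\<^sup>2 - s\<^sup>2 q(s x)\<close> with Dirichlet conditions; it is
  \<open>L\<^sub>+\<^sup>s\<close> for \<open>q = g\<close> and \<open>L\<^sub>-\<^sup>s\<close> for \<open>q = h\<close>.
\<close>

definition L_op :: "real \<Rightarrow> (real \<Rightarrow> real) \<Rightarrow> real \<Rightarrow> real oper" where
  "L_op l q s = {(u, f). u \<in> H2 l \<inter> H10 l \<and> f \<in> L2 l \<and>
     (\<exists>u' u''. H1_deriv l u u' \<and> H1_deriv l u' u'' \<and>
        ae_eq l f (\<lambda>x. - u'' x - s\<^sup>2 * q (s * x) * u x))}"

definition N_op :: "real \<Rightarrow> (real \<Rightarrow> real) \<Rightarrow> (real \<Rightarrow> real) \<Rightarrow> real \<Rightarrow> (real \<times> real) oper" where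
  "N_op l g h s = {(\<lambda>x. (u x, v x), \<lambda>x. (- p x, q x)) | u v p q.
     (u, q) \<in> L_op l g s \<and> (v, p) \<in> L_op l h s}"

definition ker :: "'a::euclidean_space oper \<Rightarrow> (real \<Rightarrow> 'a) set" where
  "ker T = {w. (w, \<lambda>_. 0) \<in> T}"

definition oper_diff :: "'a::euclidean_space oper \<Rightarrow> real \<Rightarrow> 'a oper" where
  "oper_diff T c = {(w, \<lambda>x. f x - c *\<^sub>R w x) | w f. (w, f) \<in> T}"

definition boundedly_invertible :: "real \<Rightarrow> 'a::euclidean_space oper \<Rightarrow> bool" where
  "boundedly_invertible l T \<longleftrightarrow>
     (\<forall>f\<in>L2 l. \<exists>w. (w, f) \<in> T) \<and>
     (\<forall>w. (w, \<lambda>_. 0) \<in> T \<longrightarrow> ae_eq l w (\<lambda>_. 0)) \<and>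
     (\<exists>C. \<forall>(w, f)\<in>T. L2_norm l w \<le> C * L2_norm l f)"

text \<open>
  The real points of the spectrum. All coefficients being real, a real \<open>c\<close> belongs to the
  spectrum of the operator on the real space iff it does so for the complexification.
\<close>

definition Spec :: "real \<Rightarrow> 'a::euclidean_space oper \<Rightarrow> real set" where
  "Spec l T = {c. \<not> boundedly_invertible l (oper_diff T c)}"

definition eigenfunction :: "real \<Rightarrow> 'a::euclidean_space oper \<Rightarrow> real \<Rightarrow> (real \<Rightarrow> 'a) \<Rightarrow> bool" where
  "eigenfunction l T c w \<longleftrightarrow> (w, \<lambda>x. c *\<^sub>R w x) \<in> T \<and> \<not> ae_eq l w (\<lambda>_. 0)"

definition ker_line :: "real \<Rightarrow> 'a::euclidean_space oper \<Rightarrow> (real \<Rightarrow> 'a) \<Rightarrow> bool" where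
  "ker_line l T w \<longleftrightarrow> w \<in> ker T \<and> \<not> ae_eq l w (\<lambda>_. 0) \<and>
     (\<forall>z\<in>ker T. \<exists>c. ae_eq l z (\<lambda>x. c *\<^sub>R w x))"

text \<open>
  The derivative \<open>u'(l)\<close> at the right endpoint, which is one-sided since \<open>u\<close> is only given
  on the closed interval.
\<close>

definition deriv_end :: "real \<Rightarrow> (real \<Rightarrow> real) \<Rightarrow> real" where
  "deriv_end l u = vector_derivative u (at l within {0..l})"

end

theory Submission
  imports Defs
begin

text \<open>
  Put \<open>y = s x\<close>. The eigenvalue problem \<open>N\<^sub>s w = s\<^sup>2 c w\<close> on \<open>(0, l)\<close> turns into the system
  \<open>u'' + g u = - c v\<close>, \<open>v'' + h v = c u\<close> on \<open>(0, s l)\<close> with Dirichlet conditions at both ends, in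
  which \<open>s\<close> occurs only through the length of the interval. Let \<open>(u1, v1)\<close> and \<open>(u2, v2)\<close> be the
  solutions that start at \<open>0\<close> with the slopes \<open>(1, 0)\<close> and \<open>(0, 1)\<close>. There is an eigenfunction for
  the eigenvalue \<open>s\<^sup>2 c\<close> as soon as the determinant \<open>D(y, c) = u1 v2 - u2 v1\<close> vanishes at \<open>y = s l\<close>.

  For \<open>c = 0\<close> the system decouples, \<open>D(y, 0) = \<phi>(y) \<psi>(y)\<close> with the fundamental solutions \<open>\<phi>\<close>
  of \<open>u'' + g u = 0\<close> and \<open>\<psi>\<close> of \<open>v'' + h v = 0\<close>, and a one-dimensional kernel of \<open>N\<close> means that
  exactly one of the two factors vanishes at \<open>T = s0 l\<close> (\<open>kernel_dichotomy\<close>). This zero is simple,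
  hence \<open>D\<^sub>y(T, 0) \<noteq> 0\<close>, and the implicit function theorem (\<open>implicit_function_C2\<close>) yields a
  curve \<open>y(c)\<close> of zeros of \<open>D\<close>; put \<open>s(c) = y(c) / l\<close>. For it to be of class \<open>C\<^sup>2\<close>, the function
  \<open>D\<close> must have continuous second partial derivatives, that is, solutions must depend on \<open>c\<close> in a
  \<open>C\<^sup>2\<close> manner. The coefficients being affine in \<open>c\<close>, the difference quotients of solutions with
  respect to \<open>c\<close> solve a linear system that depends continuously on its parameters
  (\<open>linear_ivp_param_derivative\<close>), so that continuous dependence on parameters suffices.

  Suppose that \<open>\<psi>(T) = 0\<close>. At \<open>c = 0\<close> the first derivatives with respect to \<open>c\<close> are \<open>\<gamma>\<close> for \<open>u2\<close>
  and \<open>\<alpha>\<close> for \<open>v1\<close>, with \<open>\<gamma>'' + g \<gamma> = - \<psi>\<close> and \<open>\<alpha>'' + h \<alpha> = \<phi>\<close>, while those of \<open>u1\<close> and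
  \<open>v2\<close> vanish. Hence \<open>D\<^sub>c(T, 0) = 0\<close>, which gives \<open>s'(0) = 0\<close>, and the second derivative of the curve is
  \<open>y''(0) = - D\<^sub>c\<^sub>c / D\<^sub>y = - (\<phi> \<omega> - 2 \<gamma> \<alpha>) / (\<phi> \<psi>')\<close> at \<open>T\<close>, where \<open>\<omega>'' + h \<omega> = 2 \<gamma>\<close>. The
  Green identity against \<open>\<psi>\<close> turns the values \<open>\<omega>(T)\<close> and \<open>\<alpha>(T)\<close> into integrals, which combine to
  the inner product of \<open>\<psi>\<close> with the solution of the Dirichlet problem with right-hand side \<open>\<psi>\<close>
  (\<open>second_variation_formula\<close>). The case \<open>\<phi>(T) = 0\<close> is the same one with \<open>g\<close> and \<open>h\<close>
  interchanged and \<open>(u, v)\<close> replaced by \<open>(v, - u)\<close>; this substitution is the source of the opposite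
  sign in the second formula.
\<close>

section \<open>Linear initial value problems that depend on a parameter\<close>

text \<open>
  The substitution \<open>t = y r\<close> moves the variable end point into the integrand, so that continuity of
  integrals over a fixed interval applies.
\<close>

lemma continuous_on_integral_upto:
  fixes f :: "real \<Rightarrow> 'p::metric_space \<Rightarrow> 'e::euclidean_space"
  assumes cont: "continuous_on UNIV (\<lambda>(t, p). f t p)"
  shows "continuous_on UNIV (\<lambda>(y, p). integral {0..max 0 y} (\<lambda>t. f t p))"
proof -
  have eq: "integral {0..max 0 y} (\<lambda>t. f t p) = max 0 y *\<^sub>R integral {0..1} (\<lambda>r. f (max 0 y * r) p)"
    for y p
  proof (cases "y > 0")
    case True
    have "continuous_on {0..y} (\<lambda>t. f t p)"
      by (rule continuous_on_compose2[OF cont, of _ "\<lambda>t. (t, p)", simplified]) (auto intro!: continuous_intros)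
    then have "((\<lambda>t. f t p) has_integral integral {0..y} (\<lambda>t. f t p)) (cbox 0 y)"
      by (simp add: integrable_continuous_interval integrable_integral)
    from has_integral_affinity'[OF this True, of 0]
    have "((\<lambda>r. f (y * r) p) has_integral integral {0..y} (\<lambda>t. f t p) /\<^sub>R y) {0..1}"
      using True by simp
    from integral_unique[OF this] True show ?thesis by simp
  qed simp
  have c: "continuous_on (UNIV \<times> cbox (0::real) 1) (\<lambda>(z, r). f (max 0 (fst z) * r) (snd z))"
    unfolding split_beta
    by (rule continuous_on_compose2[OF cont, of _ "\<lambda>x. (max 0 (fst (fst x)) * snd x, snd (fst x))", simplified])
      (auto intro!: continuous_intros)
  have "continuous_on UNIV (\<lambda>z. integral (cbox 0 1) (\<lambda>r. f (max 0 (fst z) * r) (snd z)))"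
    by (rule integral_continuous_on_param[OF c])
  then show ?thesis
    unfolding split_beta eq by (auto intro!: continuous_intros)
qed

text \<open>
  The integral equation is solved for all parameters at once, in the space of bounded continuous
  functions of \<open>(t, p)\<close>; joint continuity of the solution is then part of the membership in that space.
  The unknown is \<open>w = exp (- K t) X\<close>, because in this exponentially weighted norm the integral
  operator is a contraction on the whole half-line. To have a problem on the whole plane, negative times are
  replaced by \<open>0\<close> in the upper limit of the integral.
\<close>

lemma lipschitz_ivp_continuous_in_parameter:
  fixes F :: "real \<Rightarrow> 'p::metric_space \<Rightarrow> 'e::euclidean_space \<Rightarrow> 'e" and x0 :: 'e
  assumes cont: "continuous_on UNIV (\<lambda>(t, p, x). F t p x)"
    and lip: "\<And>t p x y. norm (F t p x - F t p y) \<le> M * norm (x - y)"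
    and zero: "\<And>t p. F t p 0 = 0"
  obtains X where "continuous_on UNIV (\<lambda>(t, p). X t p)" "\<And>p. X 0 p = x0"
    "\<And>t p. t \<ge> 0 \<Longrightarrow> ((\<lambda>t. X t p) has_vector_derivative F t p (X t p)) (at t within {0..})"
proof -
  \<comment> \<open>With this rate the contraction constant below is M / K, which is at most 1/2.\<close>
  define K where "K = 2 * (\<bar>M\<bar> + 1)"
  have K: "K > 0" "M \<le> K / 2" by (auto simp: K_def)
  define G where "G w t p = F t p (exp (K * t) *\<^sub>R w (t, p))" for w :: "real \<times> 'p \<Rightarrow> 'e" and t p
  define I where "I w = (\<lambda>(y, p). integral {0..max 0 y} (\<lambda>t. G w t p))" for w
  define T where "T w = (\<lambda>(y, p). exp (- K * max 0 y) *\<^sub>R (x0 + I w (y, p)))" for w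
  have contG: "continuous_on UNIV (\<lambda>(t, p). G w t p)" if "continuous_on UNIV w" for w
    unfolding G_def split_beta prod.collapse
    by (rule continuous_on_compose2[OF cont, of _ "\<lambda>z. (fst z, snd z, exp (K * fst z) *\<^sub>R w z)", simplified])
      (auto intro!: continuous_intros continuous_on_subset[OF that])
  have contGp: "continuous_on S (\<lambda>t. G w t p)" if "continuous_on UNIV w" for w p S
    by (rule continuous_on_compose2[OF contG[OF that], of _ "\<lambda>t. (t, p)", simplified])
      (auto intro!: continuous_intros)
  have intG: "(\<lambda>t. G w t p) integrable_on {0..y}" if "continuous_on UNIV w" for w y p
    by (rule integrable_continuous_interval contGp that)+
  have contT: "continuous_on UNIV (T w)" if "continuous_on UNIV w" for w
    using continuous_on_integral_upto[OF contG[OF that]]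
    unfolding T_def I_def split_beta by (auto intro!: continuous_intros)
  have contr: "norm (T w z - T v z) \<le> 1/2 * d"
    if w: "continuous_on UNIV w" and v: "continuous_on UNIV v" and d: "\<And>z. norm (w z - v z) \<le> d" for w v d z
  proof -
    obtain y p where z: "z = (y, p)" by (cases z)
    define Y where "Y = max 0 y"
    have Y: "Y \<ge> 0" by (simp add: Y_def)
    have d0: "d \<ge> 0" using d[of z] norm_ge_zero order_trans by blast
    have e: "((\<lambda>t. K/2 * d * exp (K * t)) has_integral (d/2 * exp (K * Y) - d/2 * exp (K * 0))) {0..Y}"
      by (rule fundamental_theorem_of_calculus[OF Y])
        (auto intro!: derivative_eq_intros simp: has_real_derivative_iff_has_vector_derivative[symmetric])
    have "norm (integral {0..Y} (\<lambda>t. G w t p - G v t p)) \<le> integral {0..Y} (\<lambda>t. K/2 * d * exp (K * t))"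
    proof (rule integral_norm_bound_integral)
      fix t assume "t \<in> {0..Y}"
      have "norm (G w t p - G v t p) \<le> M * norm (exp (K * t) *\<^sub>R w (t, p) - exp (K * t) *\<^sub>R v (t, p))"
        unfolding G_def by (rule lip)
      also have "\<dots> = M * exp (K * t) * norm (w (t, p) - v (t, p))"
        by (simp flip: scaleR_diff_right)
      also have "\<dots> \<le> K/2 * exp (K * t) * d"
        using K d[of "(t, p)"] d0 by (intro mult_mono) auto
      finally show "norm (G w t p - G v t p) \<le> K/2 * d * exp (K * t)" by (simp add: algebra_simps)
    qed (use e intG w v in \<open>auto intro!: integrable_diff\<close>)
    also have "\<dots> \<le> d/2 * exp (K * Y)" using integral_unique[OF e] d0 by simp
    finally have *: "norm (I w z - I v z) \<le> d/2 * exp (K * Y)"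
      unfolding I_def z Y_def[symmetric] using intG w v by (simp add: integral_diff Y_def)
    have "norm (T w z - T v z) = exp (- K * Y) * norm (I w z - I v z)"
      by (simp add: T_def z Y_def flip: scaleR_diff_right)
    also have "\<dots> \<le> exp (- K * Y) * (d/2 * exp (K * Y))"
      using * by (intro mult_left_mono) auto
    also have "\<dots> = 1/2 * d" by (simp add: exp_minus field_simps)
    finally show ?thesis .
  qed
  have bndT: "T w \<in> bcontfun" if bcw: "w \<in> bcontfun" for w
  proof -
    have w: "continuous_on UNIV w" using bcw by (simp add: bcontfun_def)
    obtain b where "\<forall>x\<in>range w. norm x \<le> b"
      using bcw unfolding bcontfun_def bounded_iff by blast
    then have b: "norm (w z) \<le> b" for z by blast
    have "norm (T (\<lambda>_. 0) z) \<le> norm x0" for z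
    proof -
      have "K * max 0 (fst z) \<ge> 0" using K by simp
      then show ?thesis
        using mult_right_mono[of "exp (- (K * max 0 (fst z)))" 1 "norm x0"]
        by (simp add: T_def I_def G_def zero split_beta)
    qed
    moreover have "norm (T w z - T (\<lambda>_. 0) z) \<le> 1/2 * b" for z
      by (rule contr[OF w]) (simp_all add: b)
    ultimately have "norm (T w z) \<le> norm x0 + 1/2 * b" for z
      using norm_triangle_sub[of "T w z" "T (\<lambda>_. 0) z"] by (meson add_mono order_trans)
    then show ?thesis by (intro bcontfun_normI contT w)
  qed
  define TB where "TB w = Bcontfun (T (apply_bcontfun w))" for w
  have TB: "apply_bcontfun (TB w) = T (apply_bcontfun w)" for w
    unfolding TB_def by (rule Bcontfun_inverse) (rule bndT, rule apply_bcontfun)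
  have "\<exists>!w. TB w = w"
  proof (rule banach_fix_type[of "1/2"], goal_cases)
    case 3 show ?case
    proof (intro allI dist_bound)
      fix w v :: "(real \<times> 'p) \<Rightarrow>\<^sub>C 'e" and z
      have "norm (T (apply_bcontfun w) z - T (apply_bcontfun v) z) \<le> 1/2 * dist w v"
        by (rule contr) (auto simp: dist_bounded simp flip: dist_norm)
      then show "dist (apply_bcontfun (TB w) z) (apply_bcontfun (TB v) z) \<le> 1/2 * dist w v" unfolding TB by (simp add: dist_norm)
    qed
  qed auto
  then obtain w where w: "TB w = w" by blast
  have cw: "continuous_on UNIV (apply_bcontfun w)" by simp
  have fix_w: "apply_bcontfun w (y, p) = exp (- K * max 0 y) *\<^sub>R (x0 + I (apply_bcontfun w) (y, p))" for y p
    using fun_cong[OF TB[of w, unfolded w], of "(y, p)"] unfolding T_def by simp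
  define X where "X t p = exp (K * t) *\<^sub>R apply_bcontfun w (t, p)" for t p
  have X: "X t p = x0 + integral {0..t} (\<lambda>t. F t p (X t p))" if "t \<ge> 0" for t p
    using that by (simp add: X_def fix_w[of t p] I_def G_def flip: exp_add)
  show thesis
  proof
    show "continuous_on UNIV (\<lambda>(t, p). X t p)"
      unfolding X_def split_beta by (auto intro!: continuous_intros)
    show "X 0 p = x0" for p using X[of 0 p] by simp
    fix t :: real and p assume t: "t \<ge> 0"
    have "continuous_on {0..t+1} (\<lambda>t. F t p (X t p))"
      using contGp[OF cw] by (simp add: X_def G_def)
    then have "((\<lambda>u. integral {0..u} (\<lambda>t. F t p (X t p))) has_vector_derivative F t p (X t p)) (at t within {0..t+1})"
      by (rule integral_has_vector_derivative) (use t in auto)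
    then have "((\<lambda>u. x0 + integral {0..u} (\<lambda>t. F t p (X t p))) has_vector_derivative F t p (X t p)) (at t within {0..t+1})"
      by (auto intro!: derivative_eq_intros)
    then have "((\<lambda>u. X u p) has_vector_derivative F t p (X t p)) (at t within {0..t+1})"
      by (rule has_vector_derivative_transform[rotated 2]) (use t X in auto)
    moreover have "at t within {0..t+1} = at t within {0..}"
      by (rule at_within_nhd[of _ "{t-1<..<t+1}"]) auto
    ultimately show "((\<lambda>u. X u p) has_vector_derivative F t p (X t p)) (at t within {0..})" by simp
  qed
qed

text \<open>
  The function \<open>exp (- 2 M t) (norm (X t))\<^sup>2\<close> is nonincreasing, nonnegative and zero at \<open>0\<close>.
\<close>

lemma ivp_uniqueness:
  fixes X :: "real \<Rightarrow> 'e::euclidean_space" and F :: "real \<Rightarrow> 'e \<Rightarrow> 'e"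
  assumes X: "\<And>t. t \<in> {0..T} \<Longrightarrow> (X has_vector_derivative X' t) (at t within {0..T})"
    and bound: "\<And>t. t \<in> {0..T} \<Longrightarrow> norm (X' t) \<le> M * norm (X t)"
    and "X 0 = 0" and t: "t \<in> {0..T}"
  shows "X t = 0"
proof -
  define E where "E t = exp (- 2 * M * t) * (X t \<bullet> X t)" for t
  define E' where "E' t = exp (- 2 * M * t) * (2 * (X t \<bullet> X' t) - 2 * M * (X t \<bullet> X t))" for t
  have E: "(E has_real_derivative E' s) (at s within {0..T})" if "s \<in> {0..T}" for s
    unfolding E_def E'_def has_field_derivative_def
    by (rule derivative_eq_intros X[OF that, unfolded has_vector_derivative_def] refl)+
      (auto simp: algebra_simps inner_commute)
  have E'_le: "E' s \<le> 0" if "s \<in> {0..T}" for s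
  proof -
    have "X s \<bullet> X' s \<le> norm (X s) * norm (X' s)" by (rule norm_cauchy_schwarz)
    also have "\<dots> \<le> norm (X s) * (M * norm (X s))"
      by (rule mult_left_mono) (auto simp: bound[OF that])
    finally have "X s \<bullet> X' s \<le> M * (X s \<bullet> X s)"
      by (simp add: power2_norm_eq_inner[symmetric] power2_eq_square algebra_simps)
    then show ?thesis unfolding E'_def by (auto simp: mult_le_0_iff)
  qed
  have "E t \<le> E 0"
  proof (rule DERIV_nonpos_imp_decreasing_open[of 0 t E])
    show "continuous_on {0..t} E"
      by (rule continuous_on_subset[OF DERIV_continuous_on[OF E]]) (use t in auto)
    show "\<exists>y. (E has_real_derivative y) (at s) \<and> y \<le> 0" if "0 < s" "s < t" for s
      using E[of s] E'_le[of s] at_within_Icc_at[of 0 s T] that t by auto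
  qed (use t in auto)
  then have "X t \<bullet> X t \<le> 0" using \<open>X 0 = 0\<close> by (simp add: E_def mult_le_0_iff)
  then show ?thesis using inner_ge_zero[of "X t"] by simp
qed

text \<open>
  Consider \<open>X' = A X + c B X\<close>. For two values \<open>c\<close> and \<open>d\<close> of the parameter, the difference
  \<open>X\<^sub>d - X\<^sub>c\<close> equals \<open>(d - c) Q\<close>, where \<open>Q\<close> is the solution of \<open>Q' = A Q + d B Q + B X\<^sub>c\<close> with
  \<open>Q 0 = 0\<close>. The pair \<open>(X\<^sub>c, Q)\<close> solves a linear system that is continuous in \<open>(c, d)\<close>, hence
  \<open>Q\<close> extends continuously to \<open>d = c\<close>, and its value there is the derivative \<open>Y\<close>.
\<close>

lemma linear_ivp_param_derivative:
  fixes A B :: "real \<Rightarrow> 'e::euclidean_space \<Rightarrow> 'e" and x0 :: 'e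
  assumes linA: "\<And>t. linear (A t)" and linB: "\<And>t. linear (B t)"
    and contA: "continuous_on UNIV (\<lambda>(t, x). A t x)" and contB: "continuous_on UNIV (\<lambda>(t, x). B t x)"
    and bndA: "\<And>t x. norm (A t x) \<le> M * norm x" and bndB: "\<And>t x. norm (B t x) \<le> M * norm x"
    and M: "M \<ge> 0"
  obtains X Y where "continuous_on UNIV (\<lambda>(t, c). X t c)" "continuous_on UNIV (\<lambda>(t, c). Y t c)"
    "\<And>c. X 0 c = x0" "\<And>c. Y 0 c = 0"
    "\<And>t c. t \<ge> 0 \<Longrightarrow> \<bar>c\<bar> \<le> 1 \<Longrightarrow>
       ((\<lambda>t. X t c) has_vector_derivative A t (X t c) + c *\<^sub>R B t (X t c)) (at t within {0..})"
    "\<And>t c. t \<ge> 0 \<Longrightarrow> \<bar>c\<bar> \<le> 1 \<Longrightarrow>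
       ((\<lambda>t. Y t c) has_vector_derivative A t (Y t c) + c *\<^sub>R B t (Y t c) + B t (X t c)) (at t within {0..})"
    "\<And>t c. t \<ge> 0 \<Longrightarrow> \<bar>c\<bar> < 1 \<Longrightarrow> ((\<lambda>c. X t c) has_vector_derivative Y t c) (at c)"
proof -
  \<comment> \<open>The parameter is truncated to [-1, 1] so that the vector field is globally Lipschitz.\<close>
  define clip :: "real \<Rightarrow> real" where "clip c = max (-1) (min 1 c)" for c
  have clip: "\<bar>clip c\<bar> \<le> 1" "continuous_on S clip" for c S
    unfolding clip_def[abs_def] by (auto intro!: continuous_intros)
  have clip_id: "clip c = c" if "\<bar>c\<bar> \<le> 1" for c using that by (auto simp: clip_def)
  define F where "F t p z = (A t (fst z) + clip (fst p) *\<^sub>R B t (fst z),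
     A t (snd z) + clip (snd p) *\<^sub>R B t (snd z) + B t (fst z))" for t p and z :: "'e \<times> 'e"
  note cA = continuous_on_compose2[OF contA, of _ "\<lambda>z. (u z, w z)" for u w, simplified]
  note cB = continuous_on_compose2[OF contB, of _ "\<lambda>z. (u z, w z)" for u w, simplified]
  have bnd_affine: "norm (A t x + c *\<^sub>R B t x) \<le> 2 * M * norm x" if "\<bar>c\<bar> \<le> 1" for t c x
  proof -
    have "\<bar>c\<bar> * norm (B t x) \<le> 1 * (M * norm x)" using that bndB by (intro mult_mono) auto
    then show ?thesis using bndA[of t x] norm_triangle_ineq[of "A t x" "c *\<^sub>R B t x"] by simp
  qed
  have bndF: "norm (F t p z) \<le> 5 * M * norm z" for t p z
  proof -
    have "norm (F t p z) \<le> norm (fst (F t p z)) + norm (snd (F t p z))"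
      by (metis norm_Pair_le prod.collapse)
    also have "\<dots> \<le> 2 * M * norm (fst z) + (2 * M * norm (snd z) + M * norm (fst z))"
      unfolding F_def fst_conv snd_conv
      by (intro add_mono bnd_affine clip order_trans[OF norm_triangle_ineq bndB[THEN add_mono[OF bnd_affine[OF clip(1)]]]])
    also have "\<dots> \<le> 2 * M * norm z + (2 * M * norm z + M * norm z)"
      using M norm_fst_le[of "fst z" "snd z"] norm_snd_le[of "snd z" "fst z"]
      by (intro add_mono mult_left_mono) auto
    finally show ?thesis by simp
  qed
  have diffF: "F t p z - F t p w = F t p (z - w)" for t p z w
    by (simp add: F_def linear_diff linA linB algebra_simps)
  obtain Z where Z: "continuous_on UNIV (\<lambda>(t, p). Z t p)" "\<And>p. Z 0 p = (x0, 0)"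
    "\<And>t p. t \<ge> 0 \<Longrightarrow> ((\<lambda>t. Z t p) has_vector_derivative F t p (Z t p)) (at t within {0..})"
  proof (rule lipschitz_ivp_continuous_in_parameter[of F "5 * M" "(x0, 0)"])
    show "continuous_on UNIV (\<lambda>(t, p, x). F t p x)"
      unfolding F_def split_beta
      by (intro continuous_intros cA cB continuous_on_compose2[OF clip(2)[of UNIV]]) auto
    show "norm (F t p x - F t p y) \<le> 5 * M * norm (x - y)" for t p x y unfolding diffF by (rule bndF)
    show "F t p 0 = 0" for t p by (simp add: F_def linA linB linear_0 flip: zero_prod_def)
  qed (use that in blast)
  define X where "X t c = fst (Z t (c, c))" for t c
  define Q where "Q t p = snd (Z t p)" for t p
  have der1: "((\<lambda>t. fst (Z t p)) has_vector_derivative A t (fst (Z t p)) + clip (fst p) *\<^sub>R B t (fst (Z t p))) (at t within {0..})"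
    if "t \<ge> 0" for t p
    using bounded_linear.has_vector_derivative[OF bounded_linear_fst Z(3)[OF that, of p]] by (simp add: F_def)
  have derQ: "((\<lambda>t. Q t p) has_vector_derivative A t (Q t p) + clip (snd p) *\<^sub>R B t (Q t p) + B t (fst (Z t p))) (at t within {0..})"
    if "t \<ge> 0" for t p
    using bounded_linear.has_vector_derivative[OF bounded_linear_snd Z(3)[OF that, of p]] by (simp add: F_def Q_def)
  have derX: "((\<lambda>t. X t c) has_vector_derivative A t (X t c) + clip c *\<^sub>R B t (X t c)) (at t within {0..})"
    if "t \<ge> 0" for t c using der1[OF that, of "(c, c)"] by (simp add: X_def)
  \<comment> \<open>The first component solves an equation that does not involve d.\<close>
  have fstZ: "fst (Z t (c, d)) = X t c" if "t \<ge> 0" for t c d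
  proof -
    have "fst (Z t (c, d)) - X t c = 0"
    proof (rule ivp_uniqueness[where T = t and M = "2 * M" and X = "\<lambda>t. fst (Z t (c, d)) - X t c"])
      fix s assume s: "s \<in> {0..t}"
      have eq: "A s (fst (Z s (c, d)) - X s c) + clip c *\<^sub>R B s (fst (Z s (c, d)) - X s c) =
          (A s (fst (Z s (c, d))) + clip c *\<^sub>R B s (fst (Z s (c, d)))) - (A s (X s c) + clip c *\<^sub>R B s (X s c))"
        by (simp add: linear_diff[OF linA] linear_diff[OF linB] scaleR_diff_right)
      show "((\<lambda>t. fst (Z t (c, d)) - X t c) has_vector_derivative
          A s (fst (Z s (c, d)) - X s c) + clip c *\<^sub>R B s (fst (Z s (c, d)) - X s c)) (at s within {0..t})"
        unfolding eq
        by (rule has_vector_derivative_within_subset[of _ _ _ "{0..}"],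
            rule has_vector_derivative_diff[OF der1[of s "(c, d)", simplified] derX])
          (use s in auto)
      show "norm (A s (fst (Z s (c, d)) - X s c) + clip c *\<^sub>R B s (fst (Z s (c, d)) - X s c)) \<le> 2 * M * norm (fst (Z s (c, d)) - X s c)"
        by (intro bnd_affine clip)
    qed (use that Z in \<open>auto simp: X_def\<close>)
    then show ?thesis by simp
  qed
  have quotient: "X t d - X t c = (d - c) *\<^sub>R Q t (c, d)" if "t \<ge> 0" "\<bar>c\<bar> \<le> 1" "\<bar>d\<bar> \<le> 1" for t c d
  proof -
    define R where "R t = X t d - X t c - (d - c) *\<^sub>R Q t (c, d)" for t
    have "R t = 0"
    proof (rule ivp_uniqueness[where T = t and M = "2 * M" and X = R])
      fix s assume s: "s \<in> {0..t}"
      have eq: "A s (R s) + d *\<^sub>R B s (R s) = A s (X s d) + clip d *\<^sub>R B s (X s d) - (A s (X s c) + clip c *\<^sub>R B s (X s c)) -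
          (d - c) *\<^sub>R (A s (Q s (c, d)) + clip d *\<^sub>R B s (Q s (c, d)) + B s (X s c))"
        using that by (simp add: R_def clip_id linear_diff linear_add linear_scale linA linB algebra_simps)
      show "(R has_vector_derivative A s (R s) + d *\<^sub>R B s (R s)) (at s within {0..t})"
        unfolding eq unfolding R_def
        by (rule has_vector_derivative_within_subset[of _ _ _ "{0..}"],
            rule has_vector_derivative_diff[OF has_vector_derivative_diff[OF derX derX]
              bounded_linear.has_vector_derivative[OF bounded_linear_scaleR_right]])
          (use s derQ[of s "(c, d)"] fstZ[of s c d] in auto)
      show "norm (A s (R s) + d *\<^sub>R B s (R s)) \<le> 2 * M * norm (R s)" using that by (intro bnd_affine)
    qed (use that Z in \<open>auto simp: R_def X_def Q_def\<close>)
    then show ?thesis by (simp add: R_def)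
  qed
  define Y where "Y t c = Q t (c, c)" for t c
  note cZ = continuous_on_compose2[OF Z(1), of _ "\<lambda>z. (u z, w z)" for u w, simplified]
  show thesis
  proof (rule that[of X Y])
    show "continuous_on UNIV (\<lambda>(t, c). X t c)" "continuous_on UNIV (\<lambda>(t, c). Y t c)"
      unfolding X_def Y_def Q_def split_beta by (intro continuous_intros cZ; simp)+
    show "X 0 c = x0" "Y 0 c = 0" for c by (simp_all add: X_def Y_def Q_def Z)
    fix t c :: real assume t: "t \<ge> 0"
    { assume c: "\<bar>c\<bar> \<le> 1"
      show "((\<lambda>t. X t c) has_vector_derivative A t (X t c) + c *\<^sub>R B t (X t c)) (at t within {0..})"
        using derX[OF t, of c] clip_id[OF c] by simp
      show "((\<lambda>t. Y t c) has_vector_derivative A t (Y t c) + c *\<^sub>R B t (Y t c) + B t (X t c)) (at t within {0..})"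
        using derQ[OF t, of "(c, c)"] clip_id[OF c] by (simp add: Y_def X_def) }
    assume c: "\<bar>c\<bar> < 1"
    have "continuous_on UNIV (\<lambda>d. Q t (c, d))"
      unfolding Q_def by (intro continuous_intros cZ)
    then have "((\<lambda>d. Q t (c, d)) \<longlongrightarrow> Q t (c, c)) (at c)"
      by (simp add: continuous_on_eq_continuous_at isCont_def)
    then have lim: "((\<lambda>d. Q t (c, d) - Q t (c, c)) \<longlongrightarrow> 0) (at c)" by (simp add: LIM_zero_iff)
    have "\<forall>\<^sub>F d in at c. d \<in> {-1<..<1}"
      using c by (intro eventually_at_in_open') auto
    then have ev: "\<forall>\<^sub>F d in at c. norm ((1 / norm (d - c)) *\<^sub>R (X t d - (X t c + (d - c) *\<^sub>R Y t c))) \<le> norm (Q t (c, d) - Q t (c, c))"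
    proof (rule eventually_mono)
      fix d assume "d \<in> {-1<..<1::real}"
      then have "X t d - X t c = (d - c) *\<^sub>R Q t (c, d)"
        using c by (intro quotient t) auto
      then have "X t d - (X t c + (d - c) *\<^sub>R Y t c) = (d - c) *\<^sub>R (Q t (c, d) - Q t (c, c))"
        by (simp add: Y_def scaleR_diff_right flip: diff_diff_add)
      then show "norm ((1 / norm (d - c)) *\<^sub>R (X t d - (X t c + (d - c) *\<^sub>R Y t c))) \<le> norm (Q t (c, d) - Q t (c, c))"
        by (auto)
    qed
    have "((\<lambda>d. (1 / norm (d - c)) *\<^sub>R (X t d - (X t c + (d - c) *\<^sub>R Y t c))) \<longlongrightarrow> 0) (at c)"
      by (rule Lim_null_comparison[OF ev]) (use lim tendsto_norm_zero in blast)
    then show "((\<lambda>c. X t c) has_vector_derivative Y t c) (at c)"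
      unfolding has_vector_derivative_def has_derivative_within
      by (auto intro: bounded_linear_intros)
  qed
qed

text \<open>
  The pair \<open>(X, Y)\<close> of a solution and its derivative in \<open>c\<close> is itself the solution of a linear system that
  is affine in \<open>c\<close>, so the previous lemma can be applied a second time.
\<close>

lemma linear_ivp_param_second_derivative:
  fixes A B :: "real \<Rightarrow> 'e::euclidean_space \<Rightarrow> 'e" and x0 :: 'e
  assumes linA: "\<And>t. linear (A t)" and linB: "\<And>t. linear (B t)"
    and contA: "continuous_on UNIV (\<lambda>(t, x). A t x)" and contB: "continuous_on UNIV (\<lambda>(t, x). B t x)"
    and bndA: "\<And>t x. norm (A t x) \<le> M * norm x" and bndB: "\<And>t x. norm (B t x) \<le> M * norm x"
    and M: "M \<ge> 0"
  obtains X Y W where "continuous_on UNIV (\<lambda>(t, c). X t c)" "continuous_on UNIV (\<lambda>(t, c). Y t c)"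
    "continuous_on UNIV (\<lambda>(t, c). W t c)"
    "\<And>c. X 0 c = x0" "\<And>c. Y 0 c = 0" "\<And>c. W 0 c = 0"
    "\<And>t c. t \<ge> 0 \<Longrightarrow> \<bar>c\<bar> < 1 \<Longrightarrow>
       ((\<lambda>t. X t c) has_vector_derivative A t (X t c) + c *\<^sub>R B t (X t c)) (at t within {0..})"
    "\<And>t c. t \<ge> 0 \<Longrightarrow> \<bar>c\<bar> < 1 \<Longrightarrow>
       ((\<lambda>t. Y t c) has_vector_derivative A t (Y t c) + c *\<^sub>R B t (Y t c) + B t (X t c)) (at t within {0..})"
    "\<And>t c. t \<ge> 0 \<Longrightarrow> \<bar>c\<bar> < 1 \<Longrightarrow>
       ((\<lambda>t. W t c) has_vector_derivative A t (W t c) + c *\<^sub>R B t (W t c) + 2 *\<^sub>R B t (Y t c)) (at t within {0..})"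
    "\<And>t c. t \<ge> 0 \<Longrightarrow> \<bar>c\<bar> < 1 \<Longrightarrow> ((\<lambda>c. X t c) has_vector_derivative Y t c) (at c)"
    "\<And>t c. t \<ge> 0 \<Longrightarrow> \<bar>c\<bar> < 1 \<Longrightarrow> ((\<lambda>c. Y t c) has_vector_derivative W t c) (at c)"
proof -
  define A2 where "A2 t z = (A t (fst z), A t (snd z) + B t (fst z))" for t and z :: "'e \<times> 'e"
  define B2 where "B2 t z = (B t (fst z), B t (snd z))" for t and z :: "'e \<times> 'e"
  note cA = continuous_on_compose2[OF contA, of _ "\<lambda>z. (u z, w z)" for u w, simplified]
  note cB = continuous_on_compose2[OF contB, of _ "\<lambda>z. (u z, w z)" for u w, simplified]
  obtain X Y where XY: "continuous_on UNIV (\<lambda>(t, c). X t c)" "continuous_on UNIV (\<lambda>(t, c). Y t c)"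
    "\<And>c. X 0 c = x0" "\<And>c. Y 0 c = 0"
    "\<And>t c. t \<ge> 0 \<Longrightarrow> \<bar>c\<bar> \<le> 1 \<Longrightarrow>
       ((\<lambda>t. X t c) has_vector_derivative A t (X t c) + c *\<^sub>R B t (X t c)) (at t within {0..})"
    "\<And>t c. t \<ge> 0 \<Longrightarrow> \<bar>c\<bar> \<le> 1 \<Longrightarrow>
       ((\<lambda>t. Y t c) has_vector_derivative A t (Y t c) + c *\<^sub>R B t (Y t c) + B t (X t c)) (at t within {0..})"
    "\<And>t c. t \<ge> 0 \<Longrightarrow> \<bar>c\<bar> < 1 \<Longrightarrow> ((\<lambda>c. X t c) has_vector_derivative Y t c) (at c)"
    by (rule linear_ivp_param_derivative[of A B M x0, OF assms]) blast
  have bnd3: "norm z \<le> 3 * M * norm w"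
    if "norm (fst z) \<le> M * norm (fst w)" "norm (snd z) \<le> M * norm (snd w) + M * norm (fst w)" for z w :: "'e \<times> 'e"
  proof -
    have "norm z \<le> norm (fst z) + norm (snd z)" by (metis norm_Pair_le prod.collapse)
    also have "\<dots> \<le> M * norm w + (M * norm w + M * norm w)"
      using that mult_left_mono[OF norm_fst_le M, of "fst w" "snd w"] mult_left_mono[OF norm_snd_le M, of "snd w" "fst w"]
      by simp
    finally show ?thesis by simp
  qed
  obtain Z V where ZV: "continuous_on UNIV (\<lambda>(t, c). Z t c)" "continuous_on UNIV (\<lambda>(t, c). V t c)"
    "\<And>c. Z 0 c = (x0, 0)" "\<And>c. V 0 c = 0"
    "\<And>t c. t \<ge> 0 \<Longrightarrow> \<bar>c\<bar> \<le> 1 \<Longrightarrow>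
       ((\<lambda>t. Z t c) has_vector_derivative A2 t (Z t c) + c *\<^sub>R B2 t (Z t c)) (at t within {0..})"
    "\<And>t c. t \<ge> 0 \<Longrightarrow> \<bar>c\<bar> \<le> 1 \<Longrightarrow>
       ((\<lambda>t. V t c) has_vector_derivative A2 t (V t c) + c *\<^sub>R B2 t (V t c) + B2 t (Z t c)) (at t within {0..})"
    "\<And>t c. t \<ge> 0 \<Longrightarrow> \<bar>c\<bar> < 1 \<Longrightarrow> ((\<lambda>c. Z t c) has_vector_derivative V t c) (at c)"
  proof (rule linear_ivp_param_derivative[of A2 B2 "3 * M" "(x0, 0)"])
    show "linear (A2 t)" "linear (B2 t)" for t
      by (auto intro!: linearI simp: A2_def B2_def linear_add linear_scale linA linB algebra_simps)
    show "continuous_on UNIV (\<lambda>(t, x). A2 t x)" "continuous_on UNIV (\<lambda>(t, x). B2 t x)"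
      unfolding A2_def B2_def split_beta by (intro continuous_intros cA cB; simp)+
    show "norm (A2 t x) \<le> 3 * M * norm x" for t x
      by (rule bnd3) (auto simp: A2_def bndA bndB intro!: order_trans[OF norm_triangle_ineq] add_mono)
    show "norm (B2 t x) \<le> 3 * M * norm x" for t x
      using bndB[of t "snd x"] M by (intro bnd3) (auto simp: B2_def bndB intro: order_trans add_increasing2)
  qed (use M in auto)
  have Z: "Z t c = (X t c, Y t c)" if t: "t \<ge> 0" and c: "\<bar>c\<bar> < 1" for t c
  proof -
    have "Z t c - (X t c, Y t c) = 0"
    proof (rule ivp_uniqueness[where T = t and M = "3 * M + 1 * (3 * M)" and X = "\<lambda>t. Z t c - (X t c, Y t c)"])
      fix s assume s: "s \<in> {0..t}"
      let ?R = "Z s c - (X s c, Y s c)"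
      show "((\<lambda>s. Z s c - (X s c, Y s c)) has_vector_derivative A2 s ?R + c *\<^sub>R B2 s ?R) (at s within {0..t})"
      proof (rule has_vector_derivative_within_subset[of _ _ _ "{0..}"])
        have "A2 s ?R + c *\<^sub>R B2 s ?R = (A2 s (Z s c) + c *\<^sub>R B2 s (Z s c)) -
           (A s (X s c) + c *\<^sub>R B s (X s c), A s (Y s c) + c *\<^sub>R B s (Y s c) + B s (X s c))"
          by (simp add: A2_def B2_def linear_diff linA linB algebra_simps)
        then show "((\<lambda>s. Z s c - (X s c, Y s c)) has_vector_derivative A2 s ?R + c *\<^sub>R B2 s ?R) (at s within {0..})"
          using has_vector_derivative_diff[OF ZV(5) has_vector_derivative_Pair[OF XY(5,6)], of s c c c] s c
          by simp
      qed auto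
      have "norm (A2 s ?R) \<le> 3 * M * norm ?R"
        by (rule bnd3) (auto simp: A2_def bndA bndB intro!: order_trans[OF norm_triangle_ineq] add_mono)
      moreover have "norm (B2 s ?R) \<le> 3 * M * norm ?R"
        using bndB[of s "snd ?R"] M by (intro bnd3) (auto simp: B2_def bndB intro: order_trans add_increasing2)
      then have "\<bar>c\<bar> * norm (B2 s ?R) \<le> 1 * (3 * M * norm ?R)" using c by (intro mult_mono) auto
      ultimately show "norm (A2 s ?R + c *\<^sub>R B2 s ?R) \<le> (3 * M + 1 * (3 * M)) * norm ?R"
        using norm_triangle_ineq[of "A2 s ?R" "c *\<^sub>R B2 s ?R"] by (simp add: algebra_simps)
    qed (use t XY ZV in auto)
    then show ?thesis by simp
  qed
  have derX: "((\<lambda>c. X t c) has_vector_derivative fst (V t c)) (at c)"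
    and derY: "((\<lambda>c. Y t c) has_vector_derivative snd (V t c)) (at c)"
    if t: "t \<ge> 0" and c: "\<bar>c\<bar> < 1" for t c
  proof -
    have op: "open {-1<..<1::real}" "c \<in> {-1<..<1}" using c by auto
    show "((\<lambda>c. X t c) has_vector_derivative fst (V t c)) (at c)"
      by (rule has_vector_derivative_transform_within_open[OF bounded_linear.has_vector_derivative[OF bounded_linear_fst ZV(7)[OF t c]] op])
        (use t in \<open>auto simp: Z\<close>)
    show "((\<lambda>c. Y t c) has_vector_derivative snd (V t c)) (at c)"
      by (rule has_vector_derivative_transform_within_open[OF bounded_linear.has_vector_derivative[OF bounded_linear_snd ZV(7)[OF t c]] op])
        (use t in \<open>auto simp: Z\<close>)
  qed
  have fstV: "fst (V t c) = Y t c" if t: "t \<ge> 0" and c: "\<bar>c\<bar> < 1" for t c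
    using vector_derivative_unique_at[OF derX[OF that] XY(7)[OF that]] .
  show thesis
  proof (rule that[of X Y "\<lambda>t c. snd (V t c)"])
    show "continuous_on UNIV (\<lambda>(t, c). snd (V t c))"
      using ZV(2) unfolding split_beta by (intro continuous_intros)
    show "((\<lambda>t. snd (V t c)) has_vector_derivative A t (snd (V t c)) + c *\<^sub>R B t (snd (V t c)) + 2 *\<^sub>R B t (Y t c)) (at t within {0..})"
      if "t \<ge> 0" "\<bar>c\<bar> < 1" for t c
    proof -
      have "snd (A2 t (V t c) + c *\<^sub>R B2 t (V t c) + B2 t (Z t c)) =
          A t (snd (V t c)) + c *\<^sub>R B t (snd (V t c)) + 2 *\<^sub>R B t (Y t c)"
        using that by (simp add: A2_def B2_def Z fstV scaleR_2 add_ac)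
      then show ?thesis
        using bounded_linear.has_vector_derivative[OF bounded_linear_snd ZV(6)[of t c]] that by simp
    qed
  qed (simp_all add: XY ZV(4) less_imp_le derY)
qed

section \<open>Implicit functions of class C2 in the plane\<close>

text \<open>
  The function \<open>f\<close> of two real variables is continuously differentiable on \<open>S\<close>, and its
  partial derivatives are \<open>ft\<close> and \<open>fc\<close>. The curried form keeps the chain rule along a graph readable.
\<close>

definition has_partials ::
  "(real \<times> real) set \<Rightarrow> (real \<Rightarrow> real \<Rightarrow> real) \<Rightarrow> (real \<Rightarrow> real \<Rightarrow> real) \<Rightarrow> (real \<Rightarrow> real \<Rightarrow> real) \<Rightarrow> bool" where
  "has_partials S f ft fc \<longleftrightarrow>
     (\<forall>z\<in>S. ((\<lambda>z. f (fst z) (snd z)) has_derivative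
        (\<lambda>d. ft (fst z) (snd z) * fst d + fc (fst z) (snd z) * snd d)) (at z)) \<and>
     continuous_on S (\<lambda>z. ft (fst z) (snd z)) \<and> continuous_on S (\<lambda>z. fc (fst z) (snd z))"

lemma has_partialsI:
  assumes op: "open T" "open C" "convex C"
    and dt: "\<And>t c. t \<in> T \<Longrightarrow> c \<in> C \<Longrightarrow> ((\<lambda>t. f t c) has_real_derivative ft t c) (at t)"
    and dc: "\<And>t c. t \<in> T \<Longrightarrow> c \<in> C \<Longrightarrow> ((\<lambda>c. f t c) has_real_derivative fc t c) (at c)"
    and ct: "continuous_on (T \<times> C) (\<lambda>z. ft (fst z) (snd z))"
    and cc: "continuous_on (T \<times> C) (\<lambda>z. fc (fst z) (snd z))"
  shows "has_partials (T \<times> C) f ft fc"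
  unfolding has_partials_def
proof (intro conjI ballI ct cc)
  fix z assume z: "z \<in> T \<times> C"
  obtain t c where tc: "z = (t, c)" "t \<in> T" "c \<in> C" using z by auto
  have "((\<lambda>(t, c). f t c) has_derivative (\<lambda>(a, b). ft t c * a + blinfun_scaleR_left (fc t c) b)) (at (t, c) within T \<times> C)"
  proof (rule has_derivative_partialsI)
    show "((\<lambda>t. f t c) has_derivative (\<lambda>a. ft t c * a)) (at t within T)"
      using dt[OF tc(2,3)] by (simp add: has_field_derivative_def has_derivative_at_withinI)
    show "((\<lambda>c. f t c) has_derivative blinfun_apply (blinfun_scaleR_left (fc t c))) (at c within C)"
      if "t \<in> T" "c \<in> C" for t c
      using dc[OF that] by (simp add: has_field_derivative_def has_derivative_at_withinI mult.commute[of _ "fc t c"])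
    have "continuous_on (T \<times> C) (\<lambda>(t, c). blinfun_scaleR_left (fc t c))"
      unfolding split_beta using cc by (intro continuous_intros)
    then show "continuous (at (t, c) within T \<times> C) (\<lambda>(t, c). blinfun_scaleR_left (fc t c))"
      using tc by (simp add: continuous_on_eq_continuous_within)
  qed (use op tc in auto)
  moreover have "at (t, c) within T \<times> C = at (t, c)"
    using tc op by (intro at_within_open open_Times) auto
  ultimately show "((\<lambda>z. f (fst z) (snd z)) has_derivative
        (\<lambda>d. ft (fst z) (snd z) * fst d + fc (fst z) (snd z) * snd d)) (at z)"
    by (simp add: tc split_beta' mult.commute)
qed

lemma has_partials_continuous:
  assumes "has_partials S f ft fc" shows "continuous_on S (\<lambda>z. f (fst z) (snd z))"
proof (rule continuous_at_imp_continuous_on, rule ballI)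
  fix z assume "z \<in> S"
  with assms show "isCont (\<lambda>z. f (fst z) (snd z)) z"
    unfolding has_partials_def by (blast intro: has_derivative_continuous)
qed

lemma has_partials_mult:
  assumes f: "has_partials S f ft fc" and g: "has_partials S g gt gc"
  shows "has_partials S (\<lambda>t c. f t c * g t c)
    (\<lambda>t c. ft t c * g t c + f t c * gt t c) (\<lambda>t c. fc t c * g t c + f t c * gc t c)"
  unfolding has_partials_def
proof (intro conjI ballI)
  fix z assume z: "z \<in> S"
  note f' = f[unfolded has_partials_def, THEN conjunct1, THEN bspec, OF z]
  note g' = g[unfolded has_partials_def, THEN conjunct1, THEN bspec, OF z]
  show "((\<lambda>z. f (fst z) (snd z) * g (fst z) (snd z)) has_derivative
     (\<lambda>d. (ft (fst z) (snd z) * g (fst z) (snd z) + f (fst z) (snd z) * gt (fst z) (snd z)) * fst d +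
          (fc (fst z) (snd z) * g (fst z) (snd z) + f (fst z) (snd z) * gc (fst z) (snd z)) * snd d)) (at z)"
    by (rule has_derivative_eq_rhs[OF has_derivative_mult[OF f' g']]) (auto simp: algebra_simps)
qed (use f g has_partials_continuous[OF f] has_partials_continuous[OF g] in
     \<open>auto simp: has_partials_def intro!: continuous_intros\<close>)

lemma has_partials_add:
  assumes f: "has_partials S f ft fc" and g: "has_partials S g gt gc"
  shows "has_partials S (\<lambda>t c. f t c + g t c) (\<lambda>t c. ft t c + gt t c) (\<lambda>t c. fc t c + gc t c)"
  unfolding has_partials_def
proof (intro conjI ballI)
  fix z assume z: "z \<in> S"
  note f' = f[unfolded has_partials_def, THEN conjunct1, THEN bspec, OF z]
  note g' = g[unfolded has_partials_def, THEN conjunct1, THEN bspec, OF z]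
  show "((\<lambda>z. f (fst z) (snd z) + g (fst z) (snd z)) has_derivative
     (\<lambda>d. (ft (fst z) (snd z) + gt (fst z) (snd z)) * fst d + (fc (fst z) (snd z) + gc (fst z) (snd z)) * snd d)) (at z)"
    by (rule has_derivative_eq_rhs[OF has_derivative_add[OF f' g']]) (auto simp: algebra_simps)
qed (use f g in \<open>auto simp: has_partials_def intro!: continuous_intros\<close>)

lemma has_partials_diff:
  assumes f: "has_partials S f ft fc" and g: "has_partials S g gt gc"
  shows "has_partials S (\<lambda>t c. f t c - g t c) (\<lambda>t c. ft t c - gt t c) (\<lambda>t c. fc t c - gc t c)"
  unfolding has_partials_def
proof (intro conjI ballI)
  fix z assume z: "z \<in> S"
  note f' = f[unfolded has_partials_def, THEN conjunct1, THEN bspec, OF z]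
  note g' = g[unfolded has_partials_def, THEN conjunct1, THEN bspec, OF z]
  show "((\<lambda>z. f (fst z) (snd z) - g (fst z) (snd z)) has_derivative
     (\<lambda>d. (ft (fst z) (snd z) - gt (fst z) (snd z)) * fst d + (fc (fst z) (snd z) - gc (fst z) (snd z)) * snd d)) (at z)"
    by (rule has_derivative_eq_rhs[OF has_derivative_diff[OF f' g']]) (auto simp: algebra_simps)
qed (use f g in \<open>auto simp: has_partials_def intro!: continuous_intros\<close>)

lemma has_partials_along_graph:
  assumes f: "has_partials S f ft fc" and y: "(y has_real_derivative d) (at c)" and S: "(y c, c) \<in> S"
  shows "((\<lambda>c. f (y c) c) has_real_derivative ft (y c) c * d + fc (y c) c) (at c)"
proof -
  have "((\<lambda>c. (y c, c)) has_derivative (\<lambda>h. (d * h, h))) (at c)"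
    using y unfolding has_field_derivative_def by (intro has_derivative_Pair has_derivative_ident)
  moreover have "((\<lambda>z. f (fst z) (snd z)) has_derivative (\<lambda>h. ft (y c) c * fst h + fc (y c) c * snd h)) (at (y c, c))"
    using f[unfolded has_partials_def, THEN conjunct1, THEN bspec, OF S] by simp
  ultimately have "((\<lambda>c. f (y c) c) has_derivative (\<lambda>h. ft (y c) c * (d * h) + fc (y c) c * h)) (at c)"
    by (auto dest: has_derivative_compose)
  then show ?thesis
    unfolding has_field_derivative_def by (rule has_derivative_eq_rhs) (auto simp: algebra_simps)
qed

text \<open>
  The inverse function theorem for \<open>G(t, c) = (f t c, c)\<close> provides a differentiable function \<open>y\<close>. Its
  derivative is \<open>- fc / ft\<close> along the graph of \<open>y\<close>, and this quotient is continuously differentiable again.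
  Only critical points \<open>c0\<close> of \<open>y\<close> are considered, where the second derivative reduces to \<open>- fcc / ft\<close>.
\<close>

lemma implicit_function_C2:
  assumes f: "has_partials S f ft fc" and ft: "has_partials S ft ftt ftc" and fc: "has_partials S fc fct fcc"
    and S: "open S" "(y0, c0) \<in> S" and zero: "f y0 c0 = 0" and nz: "ft y0 c0 \<noteq> 0" and crit: "fc y0 c0 = 0"
  obtains \<epsilon> y y' y'' where "\<epsilon> > 0" "y c0 = y0"
    "\<And>c. dist c0 c < \<epsilon> \<Longrightarrow> (y c, c) \<in> S"
    "\<And>c. dist c0 c < \<epsilon> \<Longrightarrow> f (y c) c = 0"
    "\<And>c. dist c0 c < \<epsilon> \<Longrightarrow> (y has_real_derivative y' c) (at c)"
    "\<And>c. dist c0 c < \<epsilon> \<Longrightarrow> (y' has_real_derivative y'' c) (at c)"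
    "continuous_on (ball c0 \<epsilon>) y''" "y' c0 = 0" "y'' c0 = - fcc y0 c0 / ft y0 c0"
proof -
  define G where "G z = (f (fst z) (snd z), snd z)" for z
  define D where "D z d = (ft (fst z) (snd z) * fst d + fc (fst z) (snd z) * snd d, snd d)" for z d :: "real \<times> real"
  have bl: "bounded_linear (D z)" for z
    unfolding D_def by (intro bounded_linear_intros)
  have D: "blinfun_apply (Blinfun (D z)) = D z" for z
    by (rule bounded_linear_Blinfun_apply[OF bl])
  have contS: "continuous_on S (\<lambda>z. ft (fst z) (snd z))" "continuous_on S (\<lambda>z. fc (fst z) (snd z))"
    using f by (auto simp: has_partials_def)
  have derG: "(G has_derivative D z) (at z)" if "z \<in> S" for z
    unfolding G_def D_def using f[unfolded has_partials_def, THEN conjunct1, THEN bspec, OF that]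
    by (intro has_derivative_Pair has_derivative_snd has_derivative_ident)
  define J where "J d = (inverse (ft y0 c0) * (fst d - fc y0 c0 * snd d), snd d)" for d :: "real \<times> real"
  have blJ: "bounded_linear J"
    unfolding J_def by (intro bounded_linear_intros)
  obtain U' V g g' where inv: "open U'" "U' \<subseteq> S" "(y0, c0) \<in> U'" "open V" "G (y0, c0) \<in> V" "homeomorphism U' V G g"
    "\<And>z. z \<in> V \<Longrightarrow> (g has_derivative (g' z)) (at z)"
    "\<And>z. z \<in> V \<Longrightarrow> bij (blinfun_apply (Blinfun (D (g z))))"
  proof (rule inverse_function_theorem[of S G "\<lambda>z. Blinfun (D z)" "(y0, c0)" "Blinfun J"])
    show "continuous_on S (\<lambda>z. Blinfun (D z))"
      by (rule continuous_on_blinfun_componentwise) (auto simp: D D_def intro!: continuous_intros contS)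
    show "Blinfun J o\<^sub>L Blinfun (D (y0, c0)) = id_blinfun"
      by (rule blinfun_eqI) (simp add: D bounded_linear_Blinfun_apply[OF blJ], simp add: J_def D_def nz field_simps)
    show "(G has_derivative blinfun_apply (Blinfun (D z))) (at z)" if "z \<in> S" for z
      using derG[OF that] by (simp add: D)
  qed (use S that in blast)+
  have V0: "(0, c0) \<in> V" using inv(5) by (simp add: G_def zero)
  have "open ((\<lambda>c. (0, c)) -` V)" using inv(4) by (intro open_vimage continuous_intros)
  then obtain \<epsilon> where e: "\<epsilon> > 0" "ball c0 \<epsilon> \<subseteq> (\<lambda>c. (0, c)) -` V"
    using V0 unfolding open_contains_ball by (meson vimageI)
  have eV: "(0, c) \<in> V" if "dist c0 c < \<epsilon>" for c using e that by auto
  define y where "y c = fst (g (0, c))" for c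
  have gV: "g z \<in> U'" "G (g z) = z" if "z \<in> V" for z
    using inv(6) that unfolding homeomorphism_def by auto
  have g0: "g (0, c) = (y c, c)" "f (y c) c = 0" if "dist c0 c < \<epsilon>" for c
    using gV(2)[OF eV[OF that]] by (auto simp: G_def y_def prod_eq_iff)
  have yS: "(y c, c) \<in> S" if "dist c0 c < \<epsilon>" for c
    using gV(1)[OF eV[OF that]] g0[OF that] inv(2) by auto
  have ftnz: "ft (y c) c \<noteq> 0" if "dist c0 c < \<epsilon>" for c
  proof
    assume "ft (y c) c = 0"
    then have "D (y c, c) (1, 0) = D (y c, c) (0, 0)" by (simp add: D_def)
    moreover have "inj (D (y c, c))"
      using inv(8)[OF eV[OF that]] g0(1)[OF that] by (simp add: D bij_def)
    ultimately have "(1 :: real, 0 :: real) = (0, 0)" by (rule injD[rotated])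
    then show False by simp
  qed
  have y0: "y c0 = y0"
    using inv(3,6) zero unfolding homeomorphism_def by (force simp: y_def G_def)
  define y' where "y' c = - fc (y c) c / ft (y c) c" for c
  define y'' where "y'' c = - (((fct (y c) c * y' c + fcc (y c) c) * ft (y c) c - fc (y c) c * (ftt (y c) c * y' c + ftc (y c) c))
     / (ft (y c) c * ft (y c) c))" for c
  have dy: "(y has_real_derivative y' c) (at c)" if c: "dist c0 c < \<epsilon>" for c
  proof -
    have "((\<lambda>c. (0 :: real, c)) has_derivative (\<lambda>h. (0, h))) (at c)"
      by (auto intro!: derivative_eq_intros)
    from has_derivative_compose[OF this, of g "g' (0, c)"]
    have "((\<lambda>c. g (0, c)) has_derivative (\<lambda>h. g' (0, c) (0, h))) (at c)"
      using inv(7)[OF eV[OF c]] by simp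
    then have "(y has_derivative (\<lambda>h. fst (g' (0, c) (0, h)))) (at c)"
      unfolding y_def by (rule has_derivative_fst)
    then obtain d where d: "(y has_real_derivative d) (at c)"
      using differentiableI real_differentiable_def by blast
    have "((\<lambda>c. f (y c) c) has_real_derivative ft (y c) c * d + fc (y c) c) (at c)"
      by (rule has_partials_along_graph[OF f d yS[OF c]])
    moreover have "((\<lambda>c. f (y c) c) has_real_derivative 0) (at c)"
      by (rule has_field_derivative_transform_within_open[of "\<lambda>_. 0" _ _ "ball c0 \<epsilon>"]) (use c g0 in auto)
    ultimately have "ft (y c) c * d + fc (y c) c = 0" by (rule DERIV_unique)
    then have "d = y' c" using ftnz[OF c] by (simp add: y'_def field_simps)
    then show ?thesis using d by simp
  qed
  have dy': "(y' has_real_derivative y'' c) (at c)" if c: "dist c0 c < \<epsilon>" for c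
    unfolding y'_def[abs_def] y''_def
    using has_partials_along_graph[OF fc dy[OF c] yS[OF c]] has_partials_along_graph[OF ft dy[OF c] yS[OF c]] ftnz[OF c]
    by (auto intro!: derivative_eq_intros simp: y'_def field_simps)
  have cy: "continuous_on (ball c0 \<epsilon>) y"
    using dy by (auto intro!: continuous_at_imp_continuous_on DERIV_isCont)
  have cy': "continuous_on (ball c0 \<epsilon>) y'"
    using dy' by (auto intro!: continuous_at_imp_continuous_on DERIV_isCont)
  have comp: "continuous_on (ball c0 \<epsilon>) (\<lambda>c. k (y c) c)" if "continuous_on S (\<lambda>z. k (fst z) (snd z))" for k :: "real \<Rightarrow> real \<Rightarrow> real"
    by (rule continuous_on_compose2[OF that, of _ "\<lambda>c. (y c, c)", simplified])
      (use yS cy in \<open>auto intro!: continuous_intros\<close>)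
  have cy'': "continuous_on (ball c0 \<epsilon>) y''"
    unfolding y''_def
    by (intro continuous_intros cy' comp)
      (use f ft fc ftnz in \<open>auto simp: has_partials_def\<close>)
  show thesis
    by (rule that[of \<epsilon> y y' y''])
      (use e y0 yS g0 dy dy' cy'' crit nz in \<open>auto simp: y'_def y''_def\<close>)
qed

section \<open>From absolutely continuous to classical solutions of the Dirichlet problem\<close>

lemma ae_eq_negligible:
  assumes "ae_eq l f g"
  obtains N where "negligible N" "\<And>x. x \<in> {0<..<l} \<Longrightarrow> x \<notin> N \<Longrightarrow> f x = g x"
proof -
  have "AE x in lebesgue. x \<in> {0<..<l} \<longrightarrow> f x = g x"
    using assms unfolding ae_eq_def by (subst (asm) AE_restrict_space_iff) auto
  then obtain N where "{x \<in> space lebesgue. \<not> (x \<in> {0<..<l} \<longrightarrow> f x = g x)} \<subseteq> N"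
    "emeasure lebesgue N = 0" "N \<in> sets lebesgue"
    by (rule AE_E)
  then have "N \<in> null_sets lebesgue" "{x \<in> space lebesgue. \<not> (x \<in> {0<..<l} \<longrightarrow> f x = g x)} \<subseteq> N"
    by (auto simp: null_sets_def)
  then show thesis by (intro that[of N]) (auto simp: negligible_iff_null_sets)
qed

lemma ae_eqI: "(\<And>x. x \<in> {0<..<l} \<Longrightarrow> f x = g x) \<Longrightarrow> ae_eq l f g"
  unfolding ae_eq_def by (intro AE_I2) auto

text \<open>
  A nonempty open set is not negligible, and the values at the end points follow by continuity.
\<close>

lemma ae_eq_continuous:
  fixes f g :: "real \<Rightarrow> 'a::euclidean_space"
  assumes ae: "ae_eq l f g" and cont: "continuous_on {0..l} f" "continuous_on {0..l} g" and l: "0 < l" and x: "x \<in> {0..l}"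
  shows "f x = g x"
proof -
  obtain N where N: "negligible N" "\<And>x. x \<in> {0<..<l} \<Longrightarrow> x \<notin> N \<Longrightarrow> f x = g x"
    by (rule ae_eq_negligible[OF ae]) blast
  have c: "continuous_on {0<..<l} (\<lambda>x. f x - g x)"
    by (intro continuous_intros continuous_on_subset[OF cont(1)] continuous_on_subset[OF cont(2)]) auto
  have "open ((\<lambda>x. f x - g x) -` (- {0}) \<inter> {0<..<l})"
    using c unfolding continuous_on_open_vimage[OF open_greaterThanLessThan] by blast
  moreover have "negligible ((\<lambda>x. f x - g x) -` (- {0}) \<inter> {0<..<l})"
    by (rule negligible_subset[OF N(1)]) (use N(2) in auto)
  ultimately have "(\<lambda>x. f x - g x) -` (- {0}) \<inter> {0<..<l} = {}"
    using open_not_negligible by blast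
  then have "f y - g y = 0" if "y \<in> {0<..<l}" for y using that by auto
  moreover have "closure {0<..<l} = {0..l}" using l by simp
  ultimately have "f x - g x = 0"
    using x by (intro continuous_constant_on_closure[of "{0<..<l}" "\<lambda>x. f x - g x" 0 x] continuous_intros) (use cont in auto)
  then show ?thesis by simp
qed

lemma continuous_imp_integrable_open_interval:
  fixes f :: "real \<Rightarrow> 'a::euclidean_space"
  assumes "continuous_on {0..l} f" shows "integrable (lebesgue_on {0<..<l}) f"
  by (rule absolutely_integrable_imp_integrable,
      rule set_integrable_subset[OF absolutely_integrable_continuous_real[OF assms]]) auto

lemma continuous_imp_L2:
  fixes f :: "real \<Rightarrow> 'a::euclidean_space"
  assumes "continuous_on {0..l} f" shows "f \<in> L2 l"
proof -
  have f: "continuous_on {0<..<l} f" by (rule continuous_on_subset[OF assms]) auto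
  have "integrable (lebesgue_on {0<..<l}) (\<lambda>x. (norm (f x))\<^sup>2)"
    by (intro continuous_imp_integrable_open_interval continuous_intros assms)
  then show ?thesis
    using continuous_imp_measurable_on_sets_lebesgue[OF f] by (simp add: L2_def)
qed

lemma integral_lebesgue_on_continuous:
  fixes f :: "real \<Rightarrow> real"
  assumes "continuous_on {0..l} f"
  shows "integral\<^sup>L (lebesgue_on {0<..<l}) f = integral {0..l} f"
  using continuous_imp_integrable_open_interval[OF assms]
  by (simp add: lebesgue_integral_eq_integral integral_open_interval_real)

text \<open>
  The classical counterpart of membership in the graph of the operator: \<open>u\<close> is twice differentiable up to the
  boundary, with first derivative \<open>u'\<close>, and \<open>- u'' - s\<^sup>2 q(s x) u = f\<close> holds everywhere.
\<close>

definition dirichlet_solution :: "real \<Rightarrow> (real \<Rightarrow> real) \<Rightarrow> real \<Rightarrow> (real \<Rightarrow> real) \<Rightarrow> (real \<Rightarrow> real) \<Rightarrow> (real \<Rightarrow> real) \<Rightarrow> bool" where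
  "dirichlet_solution l q s f u u' \<longleftrightarrow> u 0 = 0 \<and> u l = 0 \<and>
     (\<forall>x\<in>{0..l}. (u has_real_derivative u' x) (at x within {0..l}) \<and>
       (u' has_real_derivative - s\<^sup>2 * q (s * x) * u x - f x) (at x within {0..l}))"

lemma H1_deriv_continuous:
  assumes "H1_deriv l u u'" "l > 0" shows "continuous_on {0..l} u"
proof -
  have u: "(u' has_integral (u x - u 0)) {0..x}" if "x \<in> {0..l}" for x
    using assms that by (simp add: H1_deriv_def)
  have "continuous_on {0..l} (\<lambda>x. u 0 + integral {0..x} u')"
    using u[of l] assms by (intro continuous_intros indefinite_integral_continuous_1) auto
  then show ?thesis
    by (rule continuous_on_eq) (simp add: integral_unique[OF u])
qed

text \<open>
  If a weak derivative agrees almost everywhere with a continuous function, then the latter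
  is the classical derivative. This is the regularity argument for solutions with continuous data.
\<close>

lemma H1_deriv_has_real_derivative:
  assumes u: "H1_deriv l u u'" and N: "negligible N" and x: "x \<in> {0..l}"
    and f: "continuous_on {0..l} f" and eq: "\<And>x. x \<in> {0<..<l} \<Longrightarrow> x \<notin> N \<Longrightarrow> u' x = f x"
  shows "(u has_real_derivative f x) (at x within {0..l})"
proof -
  have int: "(f has_integral (u x - u 0)) {0..x}" if "x \<in> {0..l}" for x
  proof (rule has_integral_spike)
    show "negligible (N \<union> {0, l})" using N by (simp add: negligible_Un)
    show "(u' has_integral (u x - u 0)) {0..x}" using u that by (simp add: H1_deriv_def)
    show "f y = u' y" if "y \<in> {0..x} - (N \<union> {0, l})" for y
      using that \<open>x \<in> {0..l}\<close> by (intro eq[symmetric]) auto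
  qed
  have "((\<lambda>x. u 0 + integral {0..x} f) has_real_derivative f x) (at x within {0..l})"
    using integral_has_real_derivative[OF f x] by (auto intro!: derivative_eq_intros)
  then show ?thesis
    by (rule has_field_derivative_transform_within[OF _ zero_less_one x])
      (simp add: integral_unique[OF int])
qed

lemma L_op_imp_dirichlet_solution:
  assumes op: "(u, f) \<in> L_op l q s" and l: "l > 0"
    and f: "continuous_on {0..l} f" and q: "continuous_on {0..l} (\<lambda>x. q (s * x))"
  obtains u' where "dirichlet_solution l q s f u u'"
proof -
  obtain u' u'' where u: "H1_deriv l u u'" and u': "H1_deriv l u' u''"
    and ae: "ae_eq l f (\<lambda>x. - u'' x - s\<^sup>2 * q (s * x) * u x)" and bc: "u 0 = 0" "u l = 0"
    using op by (auto simp: L_op_def H10_def)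
  obtain N where N: "negligible N" "\<And>x. x \<in> {0<..<l} \<Longrightarrow> x \<notin> N \<Longrightarrow> f x = - u'' x - s\<^sup>2 * q (s * x) * u x"
    by (rule ae_eq_negligible[OF ae]) blast
  have cu: "continuous_on {0..l} u" "continuous_on {0..l} u'"
    using H1_deriv_continuous u u' l by auto
  have "dirichlet_solution l q s f u u'"
    unfolding dirichlet_solution_def
  proof (intro conjI ballI bc)
    fix x assume x: "x \<in> {0..l}"
    show "(u has_real_derivative u' x) (at x within {0..l})"
      by (rule H1_deriv_has_real_derivative[OF u negligible_empty x cu(2)]) simp
    show "(u' has_real_derivative - s\<^sup>2 * q (s * x) * u x - f x) (at x within {0..l})"
      by (rule H1_deriv_has_real_derivative[OF u' N(1) x]) (use N(2) in \<open>auto intro!: continuous_intros q cu f\<close>)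
  qed
  then show thesis by (rule that)
qed

lemma H1_derivI:
  assumes der: "\<And>x. x \<in> {0..l} \<Longrightarrow> (u has_real_derivative u' x) (at x within {0..l})" and c: "continuous_on {0..l} u'"
  shows "H1_deriv l u u'"
  unfolding H1_deriv_def
proof (intro conjI ballI)
  fix x assume x: "x \<in> {0..l}"
  show "(u' has_integral (u x - u 0)) {0..x}"
  proof (rule fundamental_theorem_of_calculus)
    show "(u has_vector_derivative u' y) (at y within {0..x})" if "y \<in> {0..x}" for y
      using DERIV_subset[OF der, of y "{0..x}"] that x by (auto simp: has_real_derivative_iff_has_vector_derivative)
  qed (use x in auto)
qed (rule continuous_imp_L2[OF c])

lemma dirichlet_solution_continuous:
  assumes "dirichlet_solution l q s f u u'"
  shows "continuous_on {0..l} u" "continuous_on {0..l} u'"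
  using assms unfolding dirichlet_solution_def by (auto intro!: DERIV_continuous_on)

lemma dirichlet_solution_imp_L_op:
  assumes d: "dirichlet_solution l q s f u u'"
    and f: "continuous_on {0..l} f" and q: "continuous_on {0..l} (\<lambda>x. q (s * x))"
  shows "(u, f) \<in> L_op l q s"
proof -
  note cu = dirichlet_solution_continuous[OF d]
  have cu'': "continuous_on {0..l} (\<lambda>x. - s\<^sup>2 * q (s * x) * u x - f x)"
    by (intro continuous_intros q f cu)
  have u: "H1_deriv l u u'"
    by (rule H1_derivI) (use d cu in \<open>auto simp: dirichlet_solution_def\<close>)
  have u': "H1_deriv l u' (\<lambda>x. - s\<^sup>2 * q (s * x) * u x - f x)"
    by (rule H1_derivI) (use d cu'' in \<open>auto simp: dirichlet_solution_def\<close>)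
  have "ae_eq l f (\<lambda>x. - (- s\<^sup>2 * q (s * x) * u x - f x) - s\<^sup>2 * q (s * x) * u x)"
    by (rule ae_eqI) simp
  then show ?thesis
    using u u' d continuous_imp_L2[OF f] unfolding L_op_def H2_def H10_def dirichlet_solution_def by blast
qed

lemma L_op_continuous: "(u, f) \<in> L_op l q s \<Longrightarrow> l > 0 \<Longrightarrow> continuous_on {0..l} u"
  by (auto simp: L_op_def intro: H1_deriv_continuous)

lemma N_op_iff:
  "(w, F) \<in> N_op l g h s \<longleftrightarrow>
     (\<lambda>x. fst (w x), \<lambda>x. snd (F x)) \<in> L_op l g s \<and> (\<lambda>x. snd (w x), \<lambda>x. - fst (F x)) \<in> L_op l h s"
proof
  assume "(\<lambda>x. fst (w x), \<lambda>x. snd (F x)) \<in> L_op l g s \<and> (\<lambda>x. snd (w x), \<lambda>x. - fst (F x)) \<in> L_op l h s"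
  then have "((\<lambda>x. (fst (w x), snd (w x))), (\<lambda>x. (- (- fst (F x)), snd (F x)))) \<in> N_op l g h s"
    unfolding N_op_def mem_Collect_eq by (intro exI conjI) (rule refl | blast)+
  then show "(w, F) \<in> N_op l g h s" by simp
qed (auto simp: N_op_def)

lemma eigenvalue_in_Spec:
  assumes "eigenfunction l T c w" shows "c \<in> Spec l T"
proof -
  have "(w, \<lambda>x. c *\<^sub>R w x) \<in> T" "\<not> ae_eq l w (\<lambda>_. 0)" using assms by (auto simp: eigenfunction_def)
  then have "(w, \<lambda>_. 0) \<in> oper_diff T c" by (force simp: oper_diff_def)
  then show ?thesis using \<open>\<not> ae_eq l w (\<lambda>_. 0)\<close> by (auto simp: Spec_def boundedly_invertible_def)
qed

text \<open>
  This is where the solutions of the two inhomogeneous problems come from.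
\<close>

lemma surjective_if_not_in_Spec:
  assumes "0 \<notin> Spec l T" "f \<in> L2 l" obtains w where "(w, f) \<in> T"
  using assms by (auto simp: Spec_def boundedly_invertible_def oper_diff_def)

section \<open>Scalar second order equations and the second variation\<close>

lemma has_real_derivative_affine:
  assumes f: "(f has_real_derivative d) (at (m * x + k) within S)" and sub: "(\<lambda>x. m * x + k) ` T \<subseteq> S"
  shows "((\<lambda>x. f (m * x + k)) has_real_derivative m * d) (at x within T)"
proof -
  have "(f \<circ> (\<lambda>x. m * x + k) has_real_derivative d * m) (at x within T)"
    by (rule DERIV_image_chain) (auto intro: DERIV_subset[OF f sub] intro!: derivative_eq_intros)
  then show ?thesis by (simp add: o_def mult.commute)
qed

text \<open>
  The equation \<open>u'' + q u = f\<close> on \<open>[0, T]\<close>, with one-sided derivatives at the end points.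
\<close>

definition solves :: "real \<Rightarrow> (real \<Rightarrow> real) \<Rightarrow> (real \<Rightarrow> real) \<Rightarrow> (real \<Rightarrow> real) \<Rightarrow> (real \<Rightarrow> real) \<Rightarrow> bool" where
  "solves T q f u u' \<longleftrightarrow> (\<forall>t\<in>{0..T}. (u has_real_derivative u' t) (at t within {0..T}) \<and>
     (u' has_real_derivative f t - q t * u t) (at t within {0..T}))"

lemma solves_continuous:
  assumes "solves T q f u u'" shows "continuous_on {0..T} u" "continuous_on {0..T} u'"
  using assms unfolding solves_def by (auto intro!: DERIV_continuous_on)

lemma solves_diff_scaled:
  assumes "solves T q f u u'" "solves T q e v v'"
  shows "solves T q (\<lambda>t. f t - k * e t) (\<lambda>t. u t - k * v t) (\<lambda>t. u' t - k * v' t)"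
  unfolding solves_def
proof (intro ballI conjI)
  fix t assume t: "t \<in> {0..T}"
  show "((\<lambda>t. u t - k * v t) has_real_derivative u' t - k * v' t) (at t within {0..T})"
    using assms t by (auto simp: solves_def intro!: derivative_eq_intros)
  have "((\<lambda>t. u' t - k * v' t) has_real_derivative (f t - q t * u t) - k * (e t - q t * v t)) (at t within {0..T})"
    using assms t by (auto simp: solves_def intro!: DERIV_diff DERIV_cmult)
  then show "((\<lambda>t. u' t - k * v' t) has_real_derivative f t - k * e t - q t * (u t - k * v t)) (at t within {0..T})"
    by (simp add: algebra_simps)
qed

lemma solves_cong:
  assumes "solves T q f u u'" "\<And>t. t \<in> {0..T} \<Longrightarrow> f t = e t"
  shows "solves T q e u u'"
  using assms by (auto simp: solves_def)

lemma solves_scaled: "solves T q f u u' \<Longrightarrow> solves T q (\<lambda>t. k * f t) (\<lambda>t. k * u t) (\<lambda>t. k * u' t)"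
  using solves_diff_scaled[of T q "\<lambda>_. 0" "\<lambda>_. 0" "\<lambda>_. 0" f u u' "-k"] by (simp add: solves_def)

lemma solves_zero_unique:
  assumes u: "solves T q (\<lambda>_. 0) u u'" and q: "continuous_on {0..T} q" and init: "u 0 = 0" "u' 0 = 0" and t: "t \<in> {0..T}"
  shows "u t = 0" "u' t = 0"
proof -
  have "bounded (q ` {0..T})"
    by (intro compact_imp_bounded compact_continuous_image q) simp
  then obtain M where "\<forall>x\<in>q ` {0..T}. norm x \<le> M" unfolding bounded_iff by blast
  then have M: "\<bar>q t\<bar> \<le> M" if "t \<in> {0..T}" for t using that by auto
  have M0: "M \<ge> 0" using M[OF t] by simp
  have "(u t, u' t) = 0"
  proof (rule ivp_uniqueness[where X = "\<lambda>t. (u t, u' t)" and M = "1 + M"])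
    fix s assume s: "s \<in> {0..T}"
    show "((\<lambda>t. (u t, u' t)) has_vector_derivative (u' s, - q s * u s)) (at s within {0..T})"
      using u s by (intro has_vector_derivative_Pair) (auto simp: solves_def has_real_derivative_iff_has_vector_derivative)
    have "norm (u' s, - q s * u s) \<le> norm (u' s) + norm (- q s * u s)" by (rule norm_Pair_le)
    also have "\<dots> \<le> norm (u s, u' s) + M * norm (u s, u' s)"
      using M[OF s] norm_snd_le[of "u' s" "u s"] norm_fst_le[of "u s" "u' s"] M0
      by (intro add_mono) (auto simp: abs_mult intro!: mult_mono)
    finally show "norm (u' s, - q s * u s) \<le> (1 + M) * norm (u s, u' s)" by (simp add: algebra_simps)
  qed (use t init in \<open>auto simp: zero_prod_def\<close>)
  then show "u t = 0" "u' t = 0" by (auto simp: zero_prod_def)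
qed

text \<open>
  Reversing the direction of time carries uniqueness from the left end point to the right one.
\<close>

lemma solves_reflect:
  assumes "solves T q (\<lambda>_. 0) u u'"
  shows "solves T (\<lambda>t. q (T - t)) (\<lambda>_. 0) (\<lambda>t. u (T - t)) (\<lambda>t. - u' (T - t))"
  unfolding solves_def
proof (intro ballI conjI)
  fix t assume "t \<in> {0..T}"
  then have t: "T - t \<in> {0..T}" by auto
  have sub: "(\<lambda>t. -1 * t + T) ` {0..T} \<subseteq> {0..T}" by auto
  show "((\<lambda>t. u (T - t)) has_real_derivative - u' (T - t)) (at t within {0..T})"
    using has_real_derivative_affine[OF _ sub, of u "u' (T - t)" t] assms t by (auto simp: solves_def)
  have "((\<lambda>t. u' (T - t)) has_real_derivative q (T - t) * u (T - t)) (at t within {0..T})"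
    using has_real_derivative_affine[OF _ sub, of u' "- (q (T - t) * u (T - t))" t] assms t by (auto simp: solves_def)
  then show "((\<lambda>t. - u' (T - t)) has_real_derivative 0 - q (T - t) * u (T - t)) (at t within {0..T})"
    by (auto intro!: derivative_eq_intros)
qed

text \<open>
  Zeros of nontrivial solutions are simple; this is what makes the implicit function theorem applicable.
\<close>

lemma solves_end_slope_nonzero:
  assumes u: "solves T q (\<lambda>_. 0) u u'" and q: "continuous_on {0..T} q" and T: "0 \<le> T" and "u T = 0" and "u' 0 \<noteq> 0"
  shows "u' T \<noteq> 0"
proof
  assume "u' T = 0"
  have "continuous_on {0..T} (\<lambda>t. q (T - t))"
    by (rule continuous_on_compose2[OF q]) (auto intro!: continuous_intros)
  from solves_zero_unique(2)[OF solves_reflect[OF u] this, of T] show False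
    using assms \<open>u' T = 0\<close> by simp
qed

lemma solves_multiple:
  assumes u: "solves T q (\<lambda>_. 0) u u'" and f: "solves T q (\<lambda>_. 0) f f'" and q: "continuous_on {0..T} q"
    and "u 0 = 0" "f 0 = 0" "f' 0 = 1" and t: "t \<in> {0..T}"
  shows "u t = u' 0 * f t" "u' t = u' 0 * f' t"
  using solves_zero_unique[OF solves_cong[OF solves_diff_scaled[OF u f, of "u' 0"]] q _ _ t, simplified] assms
  by auto

text \<open>
  The integrand is the derivative of \<open>w' v - w v'\<close>.
\<close>

lemma green_identity:
  assumes w: "solves T q f w w'" and v: "solves T q (\<lambda>_. 0) v v'" and T: "0 \<le> T"
    and "w 0 = 0" "v 0 = 0" "v T = 0"
  shows "((\<lambda>t. f t * v t) has_integral - (w T * v' T)) {0..T}"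
proof -
  define E where "E t = w' t * v t - w t * v' t" for t
  have "((\<lambda>t. f t * v t) has_integral (E T - E 0)) {0..T}"
  proof (rule fundamental_theorem_of_calculus[OF T])
    fix t assume t: "t \<in> {0..T}"
    have "(E has_real_derivative (f t - q t * w t) * v t + w' t * v' t - (w' t * v' t + w t * (0 - q t * v t))) (at t within {0..T})"
      unfolding E_def using w v t by (auto simp: solves_def intro!: derivative_eq_intros)
    then show "(E has_vector_derivative f t * v t) (at t within {0..T})"
      by (simp add: has_real_derivative_iff_has_vector_derivative algebra_simps)
  qed
  then show ?thesis using assms by (simp add: E_def)
qed

lemma dirichlet_solution_imp_solves:
  assumes d: "dirichlet_solution l q s f u u'" and s: "s > 0"
  shows "solves (s * l) q (\<lambda>y. - f (y / s) / s\<^sup>2) (\<lambda>y. u (y / s)) (\<lambda>y. u' (y / s) / s)"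
  unfolding solves_def
proof (intro ballI conjI)
  fix t assume "t \<in> {0..s * l}"
  then have t: "t / s \<in> {0..l}" using s by (auto simp: field_simps)
  have sub: "(\<lambda>t. 1 / s * t + 0) ` {0..s * l} \<subseteq> {0..l}" using s by (auto simp: field_simps)
  show "((\<lambda>y. u (y / s)) has_real_derivative u' (t / s) / s) (at t within {0..s * l})"
    using has_real_derivative_affine[OF _ sub, of u "u' (t / s)" t] d t by (auto simp: dirichlet_solution_def)
  have "((\<lambda>y. u' (y / s)) has_real_derivative (- s\<^sup>2 * q t * u (t / s) - f (t / s)) / s) (at t within {0..s * l})"
    using has_real_derivative_affine[OF _ sub, of u' "- s\<^sup>2 * q t * u (t / s) - f (t / s)" t]
      d[unfolded dirichlet_solution_def, THEN conjunct2, THEN conjunct2, THEN bspec, OF t] s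
    by auto
  from DERIV_cdivide[OF this, of s]
  have "((\<lambda>y. u' (y / s) / s) has_real_derivative (- s\<^sup>2 * q t * u (t / s) - f (t / s)) / s / s) (at t within {0..s * l})" .
  moreover have "(- s\<^sup>2 * q t * u (t / s) - f (t / s)) / s / s = - f (t / s) / s\<^sup>2 - q t * u (t / s)"
    using s by (simp add: field_simps power2_eq_square)
  ultimately show "((\<lambda>y. u' (y / s) / s) has_real_derivative - f (t / s) / s\<^sup>2 - q t * u (t / s)) (at t within {0..s * l})"
    by simp
qed

lemma solves_imp_dirichlet_solution:
  assumes u: "solves T q f u u'" and s: "s > 0" "s * l \<le> T" and bc: "u 0 = 0" "u (s * l) = 0"
  shows "dirichlet_solution l q s (\<lambda>x. - s\<^sup>2 * f (s * x)) (\<lambda>x. u (s * x)) (\<lambda>x. s * u' (s * x))"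
  unfolding dirichlet_solution_def
proof (intro ballI conjI)
  fix x assume x: "x \<in> {0..l}"
  have sub: "(\<lambda>t. s * t + 0) ` {0..l} \<subseteq> {0..T}"
    using s by (auto intro: order_trans[OF mult_left_mono])
  then have sx: "s * x \<in> {0..T}" using subsetD[OF sub imageI[OF x]] by simp
  show "((\<lambda>x. u (s * x)) has_real_derivative s * u' (s * x)) (at x within {0..l})"
    using has_real_derivative_affine[OF _ sub, of u "u' (s * x)" x] u sx by (auto simp: solves_def)
  have "((\<lambda>x. u' (s * x)) has_real_derivative s * (f (s * x) - q (s * x) * u (s * x))) (at x within {0..l})"
    using has_real_derivative_affine[OF _ sub, of u' "f (s * x) - q (s * x) * u (s * x)" x] u sx by (auto simp: solves_def)
  from DERIV_cmult[OF this, of s]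
  show "((\<lambda>x. s * u' (s * x)) has_real_derivative - s\<^sup>2 * q (s * x) * u (s * x) - - s\<^sup>2 * f (s * x)) (at x within {0..l})"
    by (simp add: algebra_simps power2_eq_square)
qed (use bc in auto)

lemma dirichlet_deriv_end:
  assumes "dirichlet_solution l q s f u u'" "l > 0" shows "deriv_end l u = u' l"
  using assms unfolding deriv_end_def dirichlet_solution_def
  by (auto intro!: vector_derivative_within_cbox[of 0 l, simplified] simp: has_real_derivative_iff_has_vector_derivative)

text \<open>
  Let \<open>W\<close> be the multiple of the rescaled \<open>w\<close> for which \<open>W'' + g W = - \<psi>\<close>. Since \<open>\<gamma>\<close>
  solves the same equation, \<open>W = \<gamma> - k \<phi>\<close>, and the boundary condition for \<open>W\<close> at \<open>T = s l\<close> gives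
  \<open>\<gamma>(T) = k \<phi>(T)\<close>. Two Green identities against \<open>\<psi>\<close> express the integral \<open>J\<close> of \<open>W \<psi>\<close> as
  \<open>- \<psi>'(T) (\<omega>(T) / 2 - k \<alpha>(T))\<close>, so that both sides of the claim are \<open>2 J / (l \<psi>'(T)\<^sup>2)\<close>. The fifth power of
  \<open>s\<close> collects the scaling of the inner product, of the right-hand side and of the slopes.
\<close>

lemma second_variation_formula:
  assumes l: "l > 0" and s: "s > 0"
    and g: "continuous_on UNIV g" and h: "continuous_on UNIV h"
    and phi: "solves (s * l) g (\<lambda>_. 0) \<phi> \<phi>'" "\<phi> 0 = 0" "\<phi>' 0 = 1" "\<phi> (s * l) \<noteq> 0"
    and psi: "solves (s * l) h (\<lambda>_. 0) \<psi> \<psi>'" "\<psi> 0 = 0" "\<psi>' 0 = 1" "\<psi> (s * l) = 0"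
    and gam: "solves (s * l) g (\<lambda>t. - \<psi> t) \<gamma> \<gamma>'" "\<gamma> 0 = 0" "\<gamma>' 0 = 0"
    and alp: "solves (s * l) h \<phi> \<alpha> \<alpha>'" "\<alpha> 0 = 0"
    and ome: "solves (s * l) h (\<lambda>t. 2 * \<gamma> t) \<omega> \<omega>'" "\<omega> 0 = 0"
    and v: "(v, \<lambda>_. 0) \<in> L_op l h s" "\<not> ae_eq l v (\<lambda>_. 0)" and w: "(w, v) \<in> L_op l g s"
  shows "deriv_end l v \<noteq> 0"
    "- (\<phi> (s * l) * \<omega> (s * l) - 2 * \<gamma> (s * l) * \<alpha> (s * l)) / (\<phi> (s * l) * \<psi>' (s * l)) / l =
     2 * s ^ 5 / l * (L2_inner l w v / (deriv_end l v)\<^sup>2)"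
proof -
  define T where "T = s * l"
  have T: "T > 0" using l s by (simp add: T_def)
  note phi = phi[folded T_def] and psi = psi[folded T_def] and gam = gam[folded T_def]
    and alp = alp[folded T_def] and ome = ome[folded T_def]
  have gT: "continuous_on {0..T} g" and hT: "continuous_on {0..T} h"
    using g h by (auto intro: continuous_on_subset)
  have cgs: "continuous_on {0..l} (\<lambda>x. g (s * x))" and chs: "continuous_on {0..l} (\<lambda>x. h (s * x))"
    by (auto intro!: continuous_intros continuous_on_compose2[OF g] continuous_on_compose2[OF h])
  obtain v' where v': "dirichlet_solution l h s (\<lambda>_. 0) v v'"
    by (rule L_op_imp_dirichlet_solution[OF v(1) l _ chs]) auto
  have cv: "continuous_on {0..l} v" by (rule dirichlet_solution_continuous[OF v'])
  obtain w' where w': "dirichlet_solution l g s v w w'"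
    by (rule L_op_imp_dirichlet_solution[OF w l cv cgs])
  have cw: "continuous_on {0..l} w" by (rule dirichlet_solution_continuous[OF w'])
  define \<kappa> where "\<kappa> = v' 0 / s"
  have V0: "solves T h (\<lambda>_. 0) (\<lambda>y. v (y / s)) (\<lambda>y. v' (y / s) / s)"
    using dirichlet_solution_imp_solves[OF v' s] by (simp add: T_def)
  have v0: "v 0 = 0" and w0: "w 0 = 0" "w l = 0" using v' w' by (auto simp: dirichlet_solution_def)
  have V: "v (y / s) = \<kappa> * \<psi> y" "v' (y / s) / s = \<kappa> * \<psi>' y" if "y \<in> {0..T}" for y
    using solves_multiple[OF V0 psi(1) hT _ psi(2,3) that] v0 by (simp_all add: \<kappa>_def)
  have vx: "v x = \<kappa> * \<psi> (s * x)" if "x \<in> {0..l}" for x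
    using V(1)[of "s * x"] that s by (auto simp: T_def)
  have kap: "\<kappa> \<noteq> 0"
  proof
    assume "\<kappa> = 0"
    then have "ae_eq l v (\<lambda>_. 0)" using vx by (intro ae_eqI) auto
    with v(2) show False ..
  qed
  have de: "deriv_end l v = s * \<kappa> * \<psi>' T"
    using dirichlet_deriv_end[OF v' l] V(2)[of T] T s by (simp add: T_def field_simps)
  have psiT: "\<psi>' T \<noteq> 0"
    by (rule solves_end_slope_nonzero[OF psi(1) hT]) (use T psi in auto)
  show "deriv_end l v \<noteq> 0" using de kap psiT s by simp
  \<comment> \<open>The factor normalises the right-hand side to - psi.\<close>
  define W where "W y = s\<^sup>2 / \<kappa> * w (y / s)" for y
  define W' where "W' y = s\<^sup>2 / \<kappa> * (w' (y / s) / s)" for y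
  have "solves T g (\<lambda>y. s\<^sup>2 / \<kappa> * (- v (y / s) / s\<^sup>2)) W W'"
    unfolding W_def W'_def T_def by (rule solves_scaled[OF dirichlet_solution_imp_solves[OF w' s]])
  then have W: "solves T g (\<lambda>y. - \<psi> y) W W'"
    by (rule solves_cong) (use V kap s in \<open>auto simp: field_simps\<close>)
  define k where "k = - W' 0"
  have Weq: "W t = \<gamma> t - k * \<phi> t" if "t \<in> {0..T}" for t
  proof -
    have "solves T g (\<lambda>_. 0) (\<lambda>t. W t - 1 * \<gamma> t) (\<lambda>t. W' t - 1 * \<gamma>' t)"
      by (rule solves_cong[OF solves_diff_scaled[OF W gam(1)]]) simp
    from solves_multiple(1)[OF this phi(1) gT _ phi(2,3) that] show ?thesis
      using gam w0 by (simp add: W_def k_def)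
  qed
  have WT: "\<gamma> T = k * \<phi> T" using Weq[of T] T w0 s by (simp add: W_def T_def)
  have i1: "((\<lambda>t. 2 * \<gamma> t * \<psi> t) has_integral - (\<omega> T * \<psi>' T)) {0..T}"
    by (rule green_identity[OF ome(1) psi(1)]) (use T ome psi in auto)
  have i2: "((\<lambda>t. \<phi> t * \<psi> t) has_integral - (\<alpha> T * \<psi>' T)) {0..T}"
    by (rule green_identity[OF alp(1) psi(1)]) (use T alp psi in auto)
  define J where "J = - (\<omega> T * \<psi>' T) / 2 + k * (\<alpha> T * \<psi>' T)"
  have "((\<lambda>t. 1/2 * (2 * \<gamma> t * \<psi> t) - k * (\<phi> t * \<psi> t)) has_integral 1/2 * - (\<omega> T * \<psi>' T) - k * - (\<alpha> T * \<psi>' T)) {0..T}"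
    by (intro has_integral_diff has_integral_mult_right i1 i2)
  then have "((\<lambda>t. W t * \<psi> t) has_integral J) {0..T}"
    unfolding J_def by (rule has_integral_eq_rhs[OF has_integral_eq[rotated]]) (auto simp: Weq algebra_simps)
  then have J: "((\<lambda>t. \<kappa>\<^sup>2 / s\<^sup>2 * (W t * \<psi> t)) has_integral \<kappa>\<^sup>2 / s\<^sup>2 * J) {0..T}"
    by (rule has_integral_mult_right)
  have "\<kappa>\<^sup>2 / s\<^sup>2 * (W t * \<psi> t) = w (t / s) * v (t / s)" if "t \<in> {0..T}" for t
    using V(1)[OF that] s kap by (simp add: W_def power2_eq_square)
  from has_integral_eq[OF this J]
  have "((\<lambda>t. w (t / s) * v (t / s)) has_integral \<kappa>\<^sup>2 / s\<^sup>2 * J) (cbox 0 T)"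
    by simp
  from has_integral_affinity'[OF this s, of 0]
  have "((\<lambda>x. w x * v x) has_integral \<kappa>\<^sup>2 / s\<^sup>2 * J / s) {0..l}"
    using s by (simp add: T_def divide_inverse mult_ac)
  then have "integral {0..l} (\<lambda>x. w x * v x) = \<kappa>\<^sup>2 / s\<^sup>2 * J / s" by (rule integral_unique)
  moreover have "L2_inner l w v = integral {0..l} (\<lambda>x. w x * v x)"
    unfolding L2_inner_def by (intro integral_lebesgue_on_continuous continuous_intros cw cv)
  ultimately have "L2_inner l w v = \<kappa>\<^sup>2 / s\<^sup>2 * J / s" by simp
  then have "2 * s ^ 5 / l * (L2_inner l w v / (deriv_end l v)\<^sup>2) = 2 * J / (l * (\<psi>' T)\<^sup>2)"
    using s kap psiT l by (simp add: de field_simps power2_eq_square power_def numeral_eq_Suc)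
  also have "\<dots> = - (\<phi> T * \<omega> T - 2 * \<gamma> T * \<alpha> T) / (\<phi> T * \<psi>' T) / l"
    using psiT l phi(4) by (simp add: J_def WT field_simps power2_eq_square)
  finally show "- (\<phi> (s * l) * \<omega> (s * l) - 2 * \<gamma> (s * l) * \<alpha> (s * l)) / (\<phi> (s * l) * \<psi>' (s * l)) / l =
     2 * s ^ 5 / l * (L2_inner l w v / (deriv_end l v)\<^sup>2)" by (simp add: T_def)
qed

section \<open>Shooting for the coupled system\<close>

text \<open>
  A state is \<open>((u, u'), (v, v'))\<close>, and the system \<open>u'' + g u = - c v\<close>, \<open>v'' + h v = c u\<close> has the vector
  field \<open>drift + c coupling\<close>.
\<close>

type_synonym state = "(real \<times> real) \<times> (real \<times> real)"

definition drift :: "(real \<Rightarrow> real) \<Rightarrow> (real \<Rightarrow> real) \<Rightarrow> real \<Rightarrow> state \<Rightarrow> state" where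
  "drift g h t x = ((snd (fst x), - g t * fst (fst x)), (snd (snd x), - h t * fst (snd x)))"

definition coupling :: "state \<Rightarrow> state" where
  "coupling x = ((0, - fst (snd x)), (0, fst (fst x)))"

text \<open>
  Solutions \<open>X\<close> of the system with initial state \<open>x0\<close>, for all \<open>c\<close> in \<open>(-1, 1)\<close>, together with
  their first and second derivatives \<open>Y\<close> and \<open>W\<close> in \<open>c\<close> and the equations that these satisfy.
\<close>

definition shooting_family ::
  "(real \<Rightarrow> real) \<Rightarrow> (real \<Rightarrow> real) \<Rightarrow> state \<Rightarrow> (real \<Rightarrow> real \<Rightarrow> state) \<Rightarrow> (real \<Rightarrow> real \<Rightarrow> state) \<Rightarrow> (real \<Rightarrow> real \<Rightarrow> state) \<Rightarrow> bool" where
  "shooting_family g h x0 X Y W \<longleftrightarrow>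
     continuous_on UNIV (\<lambda>z. X (fst z) (snd z)) \<and> continuous_on UNIV (\<lambda>z. Y (fst z) (snd z)) \<and>
     continuous_on UNIV (\<lambda>z. W (fst z) (snd z)) \<and>
     (\<forall>c. X 0 c = x0 \<and> Y 0 c = 0 \<and> W 0 c = 0) \<and>
     (\<forall>t\<ge>0. \<forall>c. \<bar>c\<bar> < 1 \<longrightarrow>
       ((\<lambda>t. X t c) has_vector_derivative drift g h t (X t c) + c *\<^sub>R coupling (X t c)) (at t within {0..}) \<and>
       ((\<lambda>t. Y t c) has_vector_derivative drift g h t (Y t c) + c *\<^sub>R coupling (Y t c) + coupling (X t c)) (at t within {0..}) \<and>
       ((\<lambda>t. W t c) has_vector_derivative drift g h t (W t c) + c *\<^sub>R coupling (W t c) + 2 *\<^sub>R coupling (Y t c)) (at t within {0..}) \<and>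
       ((\<lambda>c. X t c) has_vector_derivative Y t c) (at c) \<and>
       ((\<lambda>c. Y t c) has_vector_derivative W t c) (at c))"

lemma norm_state_le:
  fixes x :: state
  shows "norm x \<le> \<bar>fst (fst x)\<bar> + \<bar>snd (fst x)\<bar> + \<bar>fst (snd x)\<bar> + \<bar>snd (snd x)\<bar>"
    "\<bar>fst (fst x)\<bar> \<le> norm x" "\<bar>snd (fst x)\<bar> \<le> norm x" "\<bar>fst (snd x)\<bar> \<le> norm x" "\<bar>snd (snd x)\<bar> \<le> norm x"
proof -
  obtain a b c d where x: "x = ((a, b), (c, d))" by (metis prod.collapse)
  show "norm x \<le> \<bar>fst (fst x)\<bar> + \<bar>snd (fst x)\<bar> + \<bar>fst (snd x)\<bar> + \<bar>snd (snd x)\<bar>"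
    using norm_Pair_le[of "(a, b)" "(c, d)"] norm_Pair_le[of a b] norm_Pair_le[of c d] by (simp add: x)
  have "norm (a, b) \<le> norm x" "norm (c, d) \<le> norm x"
    unfolding x by (rule norm_fst_le norm_snd_le)+
  then show "\<bar>fst (fst x)\<bar> \<le> norm x" "\<bar>snd (fst x)\<bar> \<le> norm x" "\<bar>fst (snd x)\<bar> \<le> norm x" "\<bar>snd (snd x)\<bar> \<le> norm x"
    using norm_fst_le[of a b] norm_snd_le[of b a] norm_fst_le[of c d] norm_snd_le[of d c] by (simp_all add: x)
qed

lemma shooting_family_exists:
  assumes g: "continuous_on UNIV g" "\<And>t. \<bar>g t\<bar> \<le> M" and h: "continuous_on UNIV h" "\<And>t. \<bar>h t\<bar> \<le> M"
  obtains X Y W where "shooting_family g h x0 X Y W"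
proof -
  have M: "M \<ge> 0" using g(2)[of 0] by simp
  note cg = continuous_on_compose2[OF g(1), of _ "\<lambda>z. k z" for k, simplified]
  note ch = continuous_on_compose2[OF h(1), of _ "\<lambda>z. k z" for k, simplified]
  obtain X Y W where "continuous_on UNIV (\<lambda>(t, c). X t c)" "continuous_on UNIV (\<lambda>(t, c). Y t c)"
    "continuous_on UNIV (\<lambda>(t, c). W t c)"
    "\<And>c. X 0 c = x0" "\<And>c. Y 0 c = 0" "\<And>c. W 0 c = 0"
    "\<And>t c. t \<ge> 0 \<Longrightarrow> \<bar>c\<bar> < 1 \<Longrightarrow>
       ((\<lambda>t. X t c) has_vector_derivative drift g h t (X t c) + c *\<^sub>R coupling (X t c)) (at t within {0..})"
    "\<And>t c. t \<ge> 0 \<Longrightarrow> \<bar>c\<bar> < 1 \<Longrightarrow>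
       ((\<lambda>t. Y t c) has_vector_derivative drift g h t (Y t c) + c *\<^sub>R coupling (Y t c) + coupling (X t c)) (at t within {0..})"
    "\<And>t c. t \<ge> 0 \<Longrightarrow> \<bar>c\<bar> < 1 \<Longrightarrow>
       ((\<lambda>t. W t c) has_vector_derivative drift g h t (W t c) + c *\<^sub>R coupling (W t c) + 2 *\<^sub>R coupling (Y t c)) (at t within {0..})"
    "\<And>t c. t \<ge> 0 \<Longrightarrow> \<bar>c\<bar> < 1 \<Longrightarrow> ((\<lambda>c. X t c) has_vector_derivative Y t c) (at c)"
    "\<And>t c. t \<ge> 0 \<Longrightarrow> \<bar>c\<bar> < 1 \<Longrightarrow> ((\<lambda>c. Y t c) has_vector_derivative W t c) (at c)"
  proof (rule linear_ivp_param_second_derivative[of "drift g h" "\<lambda>_. coupling" "2 + 2 * M" x0])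
    show "linear (drift g h t)" "linear coupling" for t
      by (auto intro!: linearI simp: drift_def coupling_def algebra_simps)
    show "continuous_on UNIV (\<lambda>(t, x). drift g h t x)" "continuous_on UNIV (\<lambda>(t :: real, x). coupling x)"
      unfolding drift_def coupling_def split_beta by (intro continuous_intros cg ch)+
    show "norm (drift g h t x) \<le> (2 + 2 * M) * norm x" for t x
    proof -
      have "\<bar>g t * fst (fst x)\<bar> \<le> M * norm x" "\<bar>h t * fst (snd x)\<bar> \<le> M * norm x"
        unfolding abs_mult using g h norm_state_le[of x] M by (auto intro!: mult_mono)
      then have "\<bar>snd (fst x)\<bar> + \<bar>g t * fst (fst x)\<bar> + \<bar>snd (snd x)\<bar> + \<bar>h t * fst (snd x)\<bar> \<le> norm x + M * norm x + norm x + M * norm x"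
        by (intro add_mono norm_state_le)
      then show ?thesis
        using norm_state_le(1)[of "drift g h t x"] by (simp add: drift_def algebra_simps)
    qed
    show "norm (coupling x) \<le> (2 + 2 * M) * norm x" for x
    proof -
      have "norm (coupling x) \<le> \<bar>fst (snd x)\<bar> + \<bar>fst (fst x)\<bar>"
        using norm_state_le(1)[of "coupling x"] by (simp add: coupling_def)
      also have "\<dots> \<le> norm x + norm x" by (intro add_mono norm_state_le)
      also have "\<dots> \<le> (2 + 2 * M) * norm x" using M by (simp add: algebra_simps)
      finally show ?thesis .
    qed
  qed (use M that in \<open>simp; blast\<close>)+
  then show thesis
    by (intro that[of X Y W]) (simp add: shooting_family_def split_beta)
qed

lemma has_partials_linear_functional:
  fixes X :: "real \<Rightarrow> real \<Rightarrow> 'e::real_normed_vector"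
  assumes k: "bounded_linear k" and op: "open T" "open C" "convex C"
    and dt: "\<And>t c. t \<in> T \<Longrightarrow> c \<in> C \<Longrightarrow> ((\<lambda>t. X t c) has_vector_derivative Xt t c) (at t)"
    and dc: "\<And>t c. t \<in> T \<Longrightarrow> c \<in> C \<Longrightarrow> ((\<lambda>c. X t c) has_vector_derivative Xc t c) (at c)"
    and ct: "continuous_on (T \<times> C) (\<lambda>z. Xt (fst z) (snd z))"
    and cc: "continuous_on (T \<times> C) (\<lambda>z. Xc (fst z) (snd z))"
  shows "has_partials (T \<times> C) (\<lambda>t c. k (X t c)) (\<lambda>t c. k (Xt t c)) (\<lambda>t c. k (Xc t c))"
proof (rule has_partialsI[OF op])
  show "((\<lambda>t. k (X t c)) has_real_derivative k (Xt t c)) (at t)"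
    "((\<lambda>c. k (X t c)) has_real_derivative k (Xc t c)) (at c)" if "t \<in> T" "c \<in> C" for t c
    unfolding has_real_derivative_iff_has_vector_derivative
    by (rule bounded_linear.has_vector_derivative[OF k] dt dc that)+
qed (intro bounded_linear.continuous_on[OF k] ct cc)+

text \<open>
  These are exactly the functions that enter the determinant \<open>u1 v2 - u2 v1\<close> and its first partial
  derivatives. Time is restricted to positive values for the domain to be open.
\<close>

lemma shooting_family_partials:
  assumes fam: "shooting_family g h x0 X Y W" and g: "continuous_on UNIV g" and h: "continuous_on UNIV h"
  defines "S \<equiv> {0<..} \<times> {-1<..<1}"
  shows "has_partials S (\<lambda>t c. fst (fst (X t c))) (\<lambda>t c. snd (fst (X t c))) (\<lambda>t c. fst (fst (Y t c)))"
    "has_partials S (\<lambda>t c. fst (snd (X t c))) (\<lambda>t c. snd (snd (X t c))) (\<lambda>t c. fst (snd (Y t c)))"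
    "has_partials S (\<lambda>t c. snd (fst (X t c))) (\<lambda>t c. - g t * fst (fst (X t c)) - c * fst (snd (X t c))) (\<lambda>t c. snd (fst (Y t c)))"
    "has_partials S (\<lambda>t c. snd (snd (X t c))) (\<lambda>t c. - h t * fst (snd (X t c)) + c * fst (fst (X t c))) (\<lambda>t c. snd (snd (Y t c)))"
    "has_partials S (\<lambda>t c. fst (fst (Y t c))) (\<lambda>t c. snd (fst (Y t c))) (\<lambda>t c. fst (fst (W t c)))"
    "has_partials S (\<lambda>t c. fst (snd (Y t c))) (\<lambda>t c. snd (snd (Y t c))) (\<lambda>t c. fst (snd (W t c)))"
proof -
  have at: "at t within {0..} = at t" if "t \<in> {0<..}" for t :: real
    using that by (intro at_within_interior) (simp add: interior_Ici[of "-1"])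
  note F = fam[unfolded shooting_family_def]
  have cX: "continuous_on A (\<lambda>z. X (fst z) (snd z))" and cY: "continuous_on A (\<lambda>z. Y (fst z) (snd z))"
    and cW: "continuous_on A (\<lambda>z. W (fst z) (snd z))" for A
    using F by (auto intro: continuous_on_subset)
  note cg = continuous_on_compose2[OF g, of _ "\<lambda>z. k z" for k, simplified]
  note ch = continuous_on_compose2[OF h, of _ "\<lambda>z. k z" for k, simplified]
  have dX: "((\<lambda>t. X t c) has_vector_derivative drift g h t (X t c) + c *\<^sub>R coupling (X t c)) (at t)"
    "((\<lambda>t. Y t c) has_vector_derivative drift g h t (Y t c) + c *\<^sub>R coupling (Y t c) + coupling (X t c)) (at t)"
    "((\<lambda>c. X t c) has_vector_derivative Y t c) (at c)"
    "((\<lambda>c. Y t c) has_vector_derivative W t c) (at c)"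
    if "t \<in> {0<..}" "c \<in> {-1<..<1}" for t c
    using F[THEN conjunct2, THEN conjunct2, THEN conjunct2, THEN conjunct2, rule_format, of t c] at[OF that(1)] that
    by (simp_all add: abs_less_iff)
  have PX: "has_partials S (\<lambda>t c. k (X t c)) (\<lambda>t c. k (drift g h t (X t c) + c *\<^sub>R coupling (X t c))) (\<lambda>t c. k (Y t c))"
    if "bounded_linear k" for k :: "state \<Rightarrow> real"
    unfolding S_def
    by (rule has_partials_linear_functional[OF that _ _ _ dX(1,3)])
      (auto intro!: continuous_intros cX cY cg ch simp: drift_def coupling_def)
  have PY: "has_partials S (\<lambda>t c. k (Y t c)) (\<lambda>t c. k (drift g h t (Y t c) + c *\<^sub>R coupling (Y t c) + coupling (X t c))) (\<lambda>t c. k (W t c))"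
    if "bounded_linear k" for k :: "state \<Rightarrow> real"
    unfolding S_def
    by (rule has_partials_linear_functional[OF that _ _ _ dX(2,4)])
      (auto intro!: continuous_intros cX cY cW cg ch simp: drift_def coupling_def)
  have bl: "bounded_linear (\<lambda>x :: state. fst (fst x))" "bounded_linear (\<lambda>x :: state. snd (fst x))"
    "bounded_linear (\<lambda>x :: state. fst (snd x))" "bounded_linear (\<lambda>x :: state. snd (snd x))"
    by (intro bounded_linear_intros)+
  show "has_partials S (\<lambda>t c. fst (fst (X t c))) (\<lambda>t c. snd (fst (X t c))) (\<lambda>t c. fst (fst (Y t c)))"
    "has_partials S (\<lambda>t c. fst (snd (X t c))) (\<lambda>t c. snd (snd (X t c))) (\<lambda>t c. fst (snd (Y t c)))"
    "has_partials S (\<lambda>t c. snd (fst (X t c))) (\<lambda>t c. - g t * fst (fst (X t c)) - c * fst (snd (X t c))) (\<lambda>t c. snd (fst (Y t c)))"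
    "has_partials S (\<lambda>t c. snd (snd (X t c))) (\<lambda>t c. - h t * fst (snd (X t c)) + c * fst (fst (X t c))) (\<lambda>t c. snd (snd (Y t c)))"
    using PX[OF bl(1)] PX[OF bl(3)] PX[OF bl(2)] PX[OF bl(4)]
    by (simp_all add: drift_def coupling_def)
  show "has_partials S (\<lambda>t c. fst (fst (Y t c))) (\<lambda>t c. snd (fst (Y t c))) (\<lambda>t c. fst (fst (W t c)))"
    "has_partials S (\<lambda>t c. fst (snd (Y t c))) (\<lambda>t c. snd (snd (Y t c))) (\<lambda>t c. fst (snd (W t c)))"
    using PY[OF bl(1)] PY[OF bl(3)] by (simp_all add: drift_def coupling_def)
qed

lemma drift_components_solve:
  assumes Z: "\<And>t. t \<ge> 0 \<Longrightarrow> (Z has_vector_derivative drift g h t (Z t) + ((0, a t), (0, b t))) (at t within {0..})"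
  shows "solves T g a (\<lambda>t. fst (fst (Z t))) (\<lambda>t. snd (fst (Z t)))"
    "solves T h b (\<lambda>t. fst (snd (Z t))) (\<lambda>t. snd (snd (Z t)))"
proof -
  have Z': "((\<lambda>t. k (Z t)) has_real_derivative k (drift g h t (Z t) + ((0, a t), (0, b t)))) (at t within {0..T})"
    if "bounded_linear k" "t \<in> {0..T}" for k :: "state \<Rightarrow> real" and t
    unfolding has_real_derivative_iff_has_vector_derivative
    by (rule has_vector_derivative_within_subset[OF bounded_linear.has_vector_derivative[OF that(1) Z]])
      (use that in auto)
  have bl: "bounded_linear (\<lambda>x :: state. fst (fst x))" "bounded_linear (\<lambda>x :: state. snd (fst x))"
    "bounded_linear (\<lambda>x :: state. fst (snd x))" "bounded_linear (\<lambda>x :: state. snd (snd x))"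
    by (intro bounded_linear_intros)+
  show "solves T g a (\<lambda>t. fst (fst (Z t))) (\<lambda>t. snd (fst (Z t)))"
    "solves T h b (\<lambda>t. fst (snd (Z t))) (\<lambda>t. snd (snd (Z t)))"
    unfolding solves_def using Z'[OF bl(1)] Z'[OF bl(2)] Z'[OF bl(3)] Z'[OF bl(4)]
    by (auto simp: drift_def)
qed

text \<open>
  At \<open>c = 0\<close> the system decouples, and the derivatives with respect to \<open>c\<close> solve scalar
  equations whose right-hand sides are lower derivatives of the other component.
\<close>

lemma shooting_family_solves:
  assumes fam: "shooting_family g h x0 X Y W"
  shows "solves T g (\<lambda>_. 0) (\<lambda>t. fst (fst (X t 0))) (\<lambda>t. snd (fst (X t 0)))"
    "solves T h (\<lambda>_. 0) (\<lambda>t. fst (snd (X t 0))) (\<lambda>t. snd (snd (X t 0)))"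
    "solves T g (\<lambda>t. - fst (snd (X t 0))) (\<lambda>t. fst (fst (Y t 0))) (\<lambda>t. snd (fst (Y t 0)))"
    "solves T h (\<lambda>t. fst (fst (X t 0))) (\<lambda>t. fst (snd (Y t 0))) (\<lambda>t. snd (snd (Y t 0)))"
    "solves T h (\<lambda>t. 2 * fst (fst (Y t 0))) (\<lambda>t. fst (snd (W t 0))) (\<lambda>t. snd (snd (W t 0)))"
proof -
  note F = fam[unfolded shooting_family_def]
  have X: "((\<lambda>t. X t 0) has_vector_derivative drift g h t (X t 0) + ((0, 0), (0, 0))) (at t within {0..})"
    and Y: "((\<lambda>t. Y t 0) has_vector_derivative drift g h t (Y t 0) + ((0, - fst (snd (X t 0))), (0, fst (fst (X t 0))))) (at t within {0..})"
    and W: "((\<lambda>t. W t 0) has_vector_derivative drift g h t (W t 0) + ((0, - 2 * fst (snd (Y t 0))), (0, 2 * fst (fst (Y t 0))))) (at t within {0..})"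
    if "t \<ge> 0" for t
    using F[THEN conjunct2, THEN conjunct2, THEN conjunct2, THEN conjunct2, rule_format, OF that, of 0]
    by (simp_all add: coupling_def flip: zero_prod_def)
  show "solves T g (\<lambda>_. 0) (\<lambda>t. fst (fst (X t 0))) (\<lambda>t. snd (fst (X t 0)))"
    "solves T h (\<lambda>_. 0) (\<lambda>t. fst (snd (X t 0))) (\<lambda>t. snd (snd (X t 0)))"
    using drift_components_solve[OF X] by blast+
  show "solves T g (\<lambda>t. - fst (snd (X t 0))) (\<lambda>t. fst (fst (Y t 0))) (\<lambda>t. snd (fst (Y t 0)))"
    "solves T h (\<lambda>t. fst (fst (X t 0))) (\<lambda>t. fst (snd (Y t 0))) (\<lambda>t. snd (snd (Y t 0)))"
    using drift_components_solve[OF Y] by blast+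
  show "solves T h (\<lambda>t. 2 * fst (fst (Y t 0))) (\<lambda>t. fst (snd (W t 0))) (\<lambda>t. snd (snd (W t 0)))"
    using drift_components_solve(2)[OF W] by blast
qed

lemma fundamental_solution_exists:
  assumes g: "continuous_on UNIV g" "\<And>t. \<bar>g t\<bar> \<le> M"
  obtains \<phi> \<phi>' where "\<And>T. solves T g (\<lambda>_. 0) \<phi> \<phi>'" "\<phi> 0 = 0" "\<phi>' 0 = 1"
proof -
  obtain X Y W where fam: "shooting_family g g ((0, 1), (0, 0)) X Y W"
    by (rule shooting_family_exists[OF g g])
  show thesis
    by (rule that[OF shooting_family_solves(1)[OF fam]]) (use fam in \<open>simp_all add: shooting_family_def\<close>)
qed

lemma has_real_derivative_zero_on_Icc:
  assumes "(f has_real_derivative d) (at 0 within {0..l})" "l > 0" "\<And>x. x \<in> {0..l} \<Longrightarrow> f x = 0"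
  shows "d = 0"
proof -
  have "(f has_real_derivative 0) (at 0 within {0..l})"
    by (rule has_field_derivative_transform_within[of "\<lambda>_. 0" 0 0 _ 1]) (use assms in auto)
  moreover have "at 0 within {0..l} \<noteq> bot"
    using assms(2) by (simp add: trivial_limit_within islimpt_Icc)
  ultimately show ?thesis
    using assms(1) unfolding has_real_derivative_iff_has_vector_derivative by (blast intro: vector_derivative_unique_within)
qed

text \<open>
  The rescaling from \<open>(0, s l)\<close> back to \<open>(0, l)\<close> produces the factor \<open>s\<^sup>2\<close> of the eigenvalue. A
  nonzero initial slope of the second component prevents the eigenfunction from vanishing.
\<close>

lemma system_solution_eigenfunction:
  assumes Z: "\<And>t. t \<ge> 0 \<Longrightarrow> (Z has_vector_derivative drift g h t (Z t) + c *\<^sub>R coupling (Z t)) (at t within {0..})"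
    and g: "continuous_on UNIV g" and h: "continuous_on UNIV h" and s: "s > 0" and l: "l > 0"
    and init: "fst (fst (Z 0)) = 0" "fst (snd (Z 0)) = 0" "snd (snd (Z 0)) \<noteq> 0"
    and final: "fst (fst (Z (s * l))) = 0" "fst (snd (Z (s * l))) = 0"
  shows "eigenfunction l (N_op l g h s) (s\<^sup>2 * c) (\<lambda>x. (fst (fst (Z (s * x))), fst (snd (Z (s * x)))))"
proof -
  have Z': "(Z has_vector_derivative drift g h t (Z t) + ((0, - c * fst (snd (Z t))), (0, c * fst (fst (Z t))))) (at t within {0..})"
    if "t \<ge> 0" for t using Z[OF that] by (simp add: coupling_def)
  note sol = drift_components_solve[OF Z', of "s * l"]
  have sl: "s * l \<le> s * l" by simp
  have d1: "dirichlet_solution l g s (\<lambda>x. s\<^sup>2 * c * fst (snd (Z (s * x)))) (\<lambda>x. fst (fst (Z (s * x)))) (\<lambda>x. s * snd (fst (Z (s * x))))"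
    using solves_imp_dirichlet_solution[OF sol(1) s sl init(1) final(1)] by (simp add: mult.assoc)
  have d2: "dirichlet_solution l h s (\<lambda>x. - (s\<^sup>2 * c * fst (fst (Z (s * x))))) (\<lambda>x. fst (snd (Z (s * x)))) (\<lambda>x. s * snd (snd (Z (s * x))))"
    using solves_imp_dirichlet_solution[OF sol(2) s sl init(2) final(2)] by (simp add: mult.assoc)
  note c1 = dirichlet_solution_continuous(1)[OF d1] and c2 = dirichlet_solution_continuous(1)[OF d2]
  have cgs: "continuous_on {0..l} (\<lambda>x. g (s * x))" and chs: "continuous_on {0..l} (\<lambda>x. h (s * x))"
    by (auto intro!: continuous_intros continuous_on_compose2[OF g] continuous_on_compose2[OF h])
  have "(\<lambda>x. fst (fst (Z (s * x))), \<lambda>x. s\<^sup>2 * c * fst (snd (Z (s * x)))) \<in> L_op l g s"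
    by (rule dirichlet_solution_imp_L_op[OF d1 _ cgs]) (intro continuous_intros c2)
  moreover have "(\<lambda>x. fst (snd (Z (s * x))), \<lambda>x. - (s\<^sup>2 * c * fst (fst (Z (s * x))))) \<in> L_op l h s"
    by (rule dirichlet_solution_imp_L_op[OF d2 _ chs]) (intro continuous_intros c1)
  moreover have "\<not> ae_eq l (\<lambda>x. (fst (fst (Z (s * x))), fst (snd (Z (s * x))))) (\<lambda>_. 0)"
  proof
    assume "ae_eq l (\<lambda>x. (fst (fst (Z (s * x))), fst (snd (Z (s * x))))) (\<lambda>_. 0)"
    then have z: "(fst (fst (Z (s * x))), fst (snd (Z (s * x)))) = 0" if "x \<in> {0..l}" for x
      by (rule ae_eq_continuous[OF _ _ _ l that]) (intro continuous_intros c1 c2)+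
    have "((\<lambda>x. fst (snd (Z (s * x)))) has_real_derivative s * snd (snd (Z (s * 0)))) (at 0 within {0..l})"
      using d2 l unfolding dirichlet_solution_def by fastforce
    then have "s * snd (snd (Z (s * 0))) = 0"
      by (rule has_real_derivative_zero_on_Icc) (use z l in \<open>auto simp: zero_prod_def\<close>)
    then show False using s init by simp
  qed
  ultimately show ?thesis
    by (simp add: eigenfunction_def N_op_iff)
qed

lemma L2_norm_diff_tendsto_0:
  fixes U :: "real \<Rightarrow> real \<Rightarrow> 'a::euclidean_space"
  assumes U: "continuous_on (I \<times> {0..l}) (\<lambda>z. U (fst z) (snd z))" and I: "open I" "c \<in> I"
  shows "((\<lambda>m. L2_norm l (\<lambda>x. U m x - U c x)) \<longlongrightarrow> 0) (at c)"
proof -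
  have Ux: "continuous_on {0..l} (U m)" if "m \<in> I" for m
    by (rule continuous_on_compose2[OF U, of _ "\<lambda>x. (m, x)", simplified]) (use that in \<open>auto intro!: continuous_intros\<close>)
  define K where "K m = integral (cbox 0 l) (\<lambda>x. (norm (U m x - U c x))\<^sup>2)" for m
  have "continuous_on (I \<times> cbox 0 l) (\<lambda>z. U c (snd z))"
    by (rule continuous_on_compose2[OF Ux[OF I(2)]]) (auto intro!: continuous_intros)
  then have "continuous_on I K"
    unfolding K_def by (intro integral_continuous_on_param) (use U in \<open>auto simp: split_beta intro!: continuous_intros\<close>)
  then have "(K \<longlongrightarrow> K c) (at c)"
    using I by (simp add: continuous_on_eq_continuous_at isCont_def)
  then have "((\<lambda>m. sqrt (K m)) \<longlongrightarrow> 0) (at c)"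
    using tendsto_real_sqrt[of K "K c"] by (simp add: K_def)
  moreover have "\<forall>\<^sub>F m in at c. sqrt (K m) = L2_norm l (\<lambda>x. U m x - U c x)"
    using eventually_at_in_open'[OF I]
  proof (rule eventually_mono)
    fix m assume m: "m \<in> I"
    show "sqrt (K m) = L2_norm l (\<lambda>x. U m x - U c x)"
      unfolding L2_norm_def K_def
      by (subst integral_lebesgue_on_continuous) (auto intro!: continuous_intros Ux m I)
  qed
  ultimately show ?thesis by (rule Lim_transform_eventually)
qed

section \<open>The curve of eigenvalues\<close>

text \<open>
  The case in which the kernel at \<open>s0\<close> comes from the operator with potential \<open>h\<close>. A combination of the two shooting
  solutions that vanishes at \<open>y(c)\<close> is \<open>u1(y(c)) (u2, v2) - u2(y(c)) (u1, v1)\<close>: its first component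
  vanishes there trivially, and its second one because it is the determinant. It does not vanish
  identically since \<open>u1(y(c))\<close> is close to \<open>\<phi>(s0 l) \<noteq> 0\<close>. Being continuous in \<open>(c, x)\<close>, it also yields
  the continuous curve of eigenfunctions; the factor \<open>k / \<phi>(s0 l)\<close> adjusts its value at \<open>c = 0\<close>.
\<close>

lemma eigenvalue_curve:
  fixes g h :: "real \<Rightarrow> real"
  assumes l: "l > 0" and s0: "s0 > 0" and b: "s0 * l < b"
    and g: "continuous_on UNIV g" "\<And>t. \<bar>g t\<bar> \<le> M" and h: "continuous_on UNIV h" "\<And>t. \<bar>h t\<bar> \<le> M"
    and phi: "\<And>T. solves T g (\<lambda>_. 0) \<phi> \<phi>'" "\<phi> 0 = 0" "\<phi>' 0 = 1" "\<phi> (s0 * l) \<noteq> 0"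
    and psi: "\<And>T. solves T h (\<lambda>_. 0) \<psi> \<psi>'" "\<psi> 0 = 0" "\<psi>' 0 = 1" "\<psi> (s0 * l) = 0"
    and k: "k \<noteq> 0"
  obtains \<epsilon> s U where "\<epsilon> > 0" "C2_on {-\<epsilon><..<\<epsilon>} s"
    "\<And>c. c \<in> {-\<epsilon><..<\<epsilon>} \<Longrightarrow> 0 < s c \<and> s c * l < b"
    "\<And>c. c \<in> {-\<epsilon><..<\<epsilon>} \<Longrightarrow> eigenfunction l (N_op l g h (s c)) ((s c)\<^sup>2 * c) (U c)"
    "\<And>c. c \<in> {-\<epsilon><..<\<epsilon>} \<Longrightarrow> ((\<lambda>m. L2_norm l (\<lambda>x. U m x - U c x)) \<longlongrightarrow> 0) (at c)"
    "\<And>x. x \<in> {0..l} \<Longrightarrow> U 0 x = (0, k * \<psi> (s0 * x))"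
    "s 0 = s0" "deriv s 0 = 0"
    "\<And>v w. (v, \<lambda>_. 0) \<in> L_op l h s0 \<Longrightarrow> \<not> ae_eq l v (\<lambda>_. 0) \<Longrightarrow> (w, v) \<in> L_op l g s0 \<Longrightarrow>
       deriv_end l v \<noteq> 0 \<and> deriv (deriv s) 0 = 2 * s0 ^ 5 / l * (L2_inner l w v / (deriv_end l v)\<^sup>2)"
proof -
  obtain X1 Y1 W1 where F1: "shooting_family g h ((0, 1), (0, 0)) X1 Y1 W1"
    by (rule shooting_family_exists[OF g h])
  obtain X2 Y2 W2 where F2: "shooting_family g h ((0, 0), (0, 1)) X2 Y2 W2"
    by (rule shooting_family_exists[OF g h])
  define S :: "(real \<times> real) set" where "S = {0<..} \<times> {-1<..<1}"
  note p1 = shooting_family_partials[OF F1 g(1) h(1), folded S_def]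
  note p2 = shooting_family_partials[OF F2 g(1) h(1), folded S_def]
  \<comment> \<open>The determinant and its first partial derivatives are differentiated by the product rule.\<close>
  note Df = has_partials_diff[OF has_partials_mult[OF p1(1) p2(2)] has_partials_mult[OF p2(1) p1(2)]]
  note Dft = has_partials_diff[OF
    has_partials_add[OF has_partials_mult[OF p1(3) p2(2)] has_partials_mult[OF p1(1) p2(4)]]
    has_partials_add[OF has_partials_mult[OF p2(3) p1(2)] has_partials_mult[OF p2(1) p1(4)]]]
  note Dfc = has_partials_diff[OF
    has_partials_add[OF has_partials_mult[OF p1(5) p2(2)] has_partials_mult[OF p1(1) p2(6)]]
    has_partials_add[OF has_partials_mult[OF p2(5) p1(2)] has_partials_mult[OF p2(1) p1(6)]]]
  define T where "T = s0 * l"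
  have T: "T > 0" using l s0 by (simp add: T_def)
  have gT: "continuous_on {0..T} g" and hT: "continuous_on {0..T} h"
    using g h by (auto intro: continuous_on_subset)
  have init1: "X1 0 c = ((0, 1), (0, 0))" "Y1 0 c = 0" "W1 0 c = 0" for c
    using F1 by (auto simp: shooting_family_def)
  have init2: "X2 0 c = ((0, 0), (0, 1))" "Y2 0 c = 0" "W2 0 c = 0" for c
    using F2 by (auto simp: shooting_family_def)
  note sol1 = shooting_family_solves[OF F1, of T] and sol2 = shooting_family_solves[OF F2, of T]
  have u1: "fst (fst (X1 t 0)) = \<phi> t" "snd (fst (X1 t 0)) = \<phi>' t" if "t \<in> {0..T}" for t
    using solves_multiple[OF sol1(1) phi(1) gT _ phi(2,3) that] by (simp_all add: init1)
  have v1: "fst (snd (X1 t 0)) = 0" "snd (snd (X1 t 0)) = 0" if "t \<in> {0..T}" for t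
    using solves_zero_unique[OF sol1(2) hT _ _ that] by (simp_all add: init1)
  have u2: "fst (fst (X2 t 0)) = 0" "snd (fst (X2 t 0)) = 0" if "t \<in> {0..T}" for t
    using solves_zero_unique[OF sol2(1) gT _ _ that] by (simp_all add: init2)
  have v2: "fst (snd (X2 t 0)) = \<psi> t" "snd (snd (X2 t 0)) = \<psi>' t" if "t \<in> {0..T}" for t
    using solves_multiple[OF sol2(2) psi(1) hT _ psi(2,3) that] by (simp_all add: init2)
  have uc1: "fst (fst (Y1 t 0)) = 0" if "t \<in> {0..T}" for t
    using solves_zero_unique(1)[OF solves_cong[OF sol1(3)] gT _ _ that] by (simp add: init1 v1)
  have vc2: "fst (snd (Y2 t 0)) = 0" if "t \<in> {0..T}" for t
    using solves_zero_unique(1)[OF solves_cong[OF sol2(4)] hT _ _ that] by (simp add: init2 u2)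
  have T0: "T \<in> {0..T}" using T by simp
  note at_T = u1[OF T0] v1[OF T0] u2[OF T0] v2[OF T0] uc1[OF T0] vc2[OF T0]
  have phiT: "\<phi> T \<noteq> 0" and psiT: "\<psi> T = 0" using phi(4) psi(4) by (simp_all add: T_def)
  have psi'T: "\<psi>' T \<noteq> 0"
    by (rule solves_end_slope_nonzero[OF psi(1) hT]) (use T psiT psi in auto)
  have S0: "open S" "(T, 0) \<in> S" using T by (auto simp: S_def open_Times)
  obtain \<delta> y y' y'' where y: "\<delta> > 0" "y 0 = T"
    "\<And>c. dist 0 c < \<delta> \<Longrightarrow> (y c, c) \<in> S"
    "\<And>c. dist 0 c < \<delta> \<Longrightarrow> fst (fst (X1 (y c) c)) * fst (snd (X2 (y c) c)) - fst (fst (X2 (y c) c)) * fst (snd (X1 (y c) c)) = 0"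
    "\<And>c. dist 0 c < \<delta> \<Longrightarrow> (y has_real_derivative y' c) (at c)"
    "\<And>c. dist 0 c < \<delta> \<Longrightarrow> (y' has_real_derivative y'' c) (at c)"
    "continuous_on (ball 0 \<delta>) y''" "y' 0 = 0"
    "y'' 0 = - (\<phi> T * fst (snd (W2 T 0)) - 2 * fst (fst (Y2 T 0)) * fst (snd (Y1 T 0))) / (\<phi> T * \<psi>' T)"
  proof (rule implicit_function_C2[OF Df Dft Dfc S0], goal_cases)
    case (4 \<delta> y y' y'')
    show ?case by (rule that[OF 4(2-9)]) (use 4(10) in \<open>auto simp add: at_T psiT\<close>)
  qed (use phiT psiT psi'T in \<open>simp_all add: at_T\<close>)
  define s where "s c = y c / l" for c
  define U where "U c x = (let Z = (k / \<phi> T) *\<^sub>R (fst (fst (X1 (y c) c)) *\<^sub>R X2 (s c * x) c - fst (fst (X2 (y c) c)) *\<^sub>R X1 (s c * x) c)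
    in (fst (fst Z), fst (snd Z)))" for c x
  have cX1: "continuous_on UNIV (\<lambda>z. X1 (fst z) (snd z))" and cX2: "continuous_on UNIV (\<lambda>z. X2 (fst z) (snd z))"
    using F1 F2 by (auto simp: shooting_family_def)
  note cX1' = continuous_on_compose2[OF cX1, of _ "\<lambda>z. (u z, w z)" for u w, simplified]
  note cX2' = continuous_on_compose2[OF cX2, of _ "\<lambda>z. (u z, w z)" for u w, simplified]
  have cy: "continuous_on (ball 0 \<delta>) y"
    using y(5) by (auto intro!: continuous_at_imp_continuous_on DERIV_isCont)
  have cy0: "continuous_on A (\<lambda>z. y (fst z))" if "A \<subseteq> ball 0 \<delta> \<times> B" for A and B :: "real set"
    by (rule continuous_on_compose2[OF cy]) (use that in \<open>auto intro!: continuous_intros\<close>)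
  have "isCont y 0" by (rule DERIV_isCont[OF y(5)]) (use y(1) in simp)
  then have lim: "(y \<longlongrightarrow> T) (nhds 0)" using y(2) by (simp add: isCont_def tendsto_nhds_iff)
  have "isCont (\<lambda>c. fst (fst (X1 (y c) c))) 0"
  proof -
    have "continuous_on (ball 0 \<delta>) (\<lambda>c. fst (fst (X1 (y c) c)))"
      by (intro continuous_intros cX1' cy)
    then show ?thesis using y(1) by (auto simp: continuous_on_eq_continuous_at)
  qed
  then have lim2: "((\<lambda>c. fst (fst (X1 (y c) c))) \<longlongrightarrow> \<phi> T) (nhds 0)"
    by (simp add: isCont_def tendsto_nhds_iff y(2) at_T)
  have "\<forall>\<^sub>F c in nhds 0. y c < b \<and> fst (fst (X1 (y c) c)) \<noteq> 0"
    using order_tendstoD(2)[OF lim, of b] tendsto_imp_eventually_ne[OF lim2 phiT] b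
    by (auto simp: T_def elim: eventually_elim2)
  then obtain d where d: "d > 0" "\<And>c. dist c 0 < d \<Longrightarrow> y c < b \<and> fst (fst (X1 (y c) c)) \<noteq> 0"
    unfolding eventually_nhds_metric by blast
  define \<epsilon> where "\<epsilon> = min d \<delta>"
  have e: "\<epsilon> > 0" using d y by (simp add: \<epsilon>_def)
  have in_e: "dist 0 c < \<delta>" "dist c 0 < d" "\<bar>c\<bar> < 1" "y c > 0" if "c \<in> {-\<epsilon><..<\<epsilon>}" for c
  proof -
    show *: "dist 0 c < \<delta>" "dist c 0 < d" using that by (auto simp: \<epsilon>_def dist_real_def)
    show "\<bar>c\<bar> < 1" "y c > 0" using y(3)[OF *(1)] by (auto simp: S_def)
  qed
  have sl: "s c * l = y c" for c using l by (simp add: s_def)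
  have sl': "l * s c = y c" for c using sl[of c] by (simp add: mult.commute)
  have ds: "(s has_real_derivative y' c / l) (at c)" if "dist 0 c < \<delta>" for c
    unfolding s_def by (intro DERIV_cdivide y that)
  have ds': "((\<lambda>c. y' c / l) has_real_derivative y'' c / l) (at c)" if "dist 0 c < \<delta>" for c
    by (intro DERIV_cdivide y that)
  have deriv_s: "deriv s c = y' c / l" if "dist 0 c < \<delta>" for c
    by (rule DERIV_imp_deriv[OF ds[OF that]])
  have "(deriv s has_real_derivative y'' 0 / l) (at 0)"
    by (rule has_field_derivative_transform_within_open[OF ds'[of 0], of "ball 0 \<delta>"]) (use y(1) deriv_s in auto)
  then have dds: "deriv (deriv s) 0 = y'' 0 / l" by (rule DERIV_imp_deriv)
  show thesis
  proof (rule that[OF e, of s U])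
    show "C2_on {-\<epsilon><..<\<epsilon>} s"
      unfolding C2_on_def
    proof (intro exI conjI ballI)
      show "(s has_real_derivative y' c / l) (at c within {-\<epsilon><..<\<epsilon>})"
        "((\<lambda>c. y' c / l) has_real_derivative y'' c / l) (at c within {-\<epsilon><..<\<epsilon>})" if "c \<in> {-\<epsilon><..<\<epsilon>}" for c
        using ds ds' in_e(1)[OF that] by (auto intro: has_field_derivative_at_within)
      show "continuous_on {-\<epsilon><..<\<epsilon>} (\<lambda>c. y'' c / l)"
        by (intro continuous_intros continuous_on_subset[OF y(7)]) (use in_e(1) l in auto)
    qed
    show "s 0 = s0" using l by (simp add: s_def y T_def)
    show "deriv s 0 = 0" using deriv_s[of 0] y by simp
    show "U 0 x = (0, k * \<psi> (s0 * x))" if "x \<in> {0..l}" for x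
    proof -
      have "s0 * x \<in> {0..T}" using that s0 by (auto simp: T_def)
      then show ?thesis
        using phiT by (simp add: U_def Let_def y(2) at_T u1 u2 v2 s_def T_def l[THEN less_imp_neq, symmetric])
    qed
    show "deriv_end l v \<noteq> 0 \<and> deriv (deriv s) 0 = 2 * s0 ^ 5 / l * (L2_inner l w v / (deriv_end l v)\<^sup>2)"
      if v: "(v, \<lambda>_. 0) \<in> L_op l h s0" "\<not> ae_eq l v (\<lambda>_. 0)" and w: "(w, v) \<in> L_op l g s0" for v w
    proof -
      have gam: "solves T g (\<lambda>t. - \<psi> t) (\<lambda>t. fst (fst (Y2 t 0))) (\<lambda>t. snd (fst (Y2 t 0)))"
        by (rule solves_cong[OF sol2(3)]) (simp add: v2)
      have alp: "solves T h \<phi> (\<lambda>t. fst (snd (Y1 t 0))) (\<lambda>t. snd (snd (Y1 t 0)))"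
        by (rule solves_cong[OF sol1(4)]) (simp add: u1)
      note f = second_variation_formula[OF l s0 g(1) h(1) phi(1-4) psi(1-4) gam[unfolded T_def] _ _ alp[unfolded T_def] _
          sol2(5)[unfolded T_def] _ v w, simplified init1 init2, simplified]
      show ?thesis using f dds y(9) by (simp add: T_def)
    qed
    fix c assume c: "c \<in> {-\<epsilon><..<\<epsilon>}"
    note ce = in_e[OF c]
    show s: "0 < s c \<and> s c * l < b"
      unfolding sl using ce d(2)[OF ce(2)] l by (simp add: s_def)
    show "eigenfunction l (N_op l g h (s c)) ((s c)\<^sup>2 * c) (U c)"
    proof -
      define Z where "Z t = (k / \<phi> T) *\<^sub>R (fst (fst (X1 (y c) c)) *\<^sub>R X2 t c - fst (fst (X2 (y c) c)) *\<^sub>R X1 t c)" for t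
      have dX: "((\<lambda>t. X1 t c) has_vector_derivative drift g h t (X1 t c) + c *\<^sub>R coupling (X1 t c)) (at t within {0..})"
        "((\<lambda>t. X2 t c) has_vector_derivative drift g h t (X2 t c) + c *\<^sub>R coupling (X2 t c)) (at t within {0..})"
        if "t \<ge> 0" for t
        using F1 F2 that ce by (auto simp: shooting_family_def)
      have "eigenfunction l (N_op l g h (s c)) ((s c)\<^sup>2 * c) (\<lambda>x. (fst (fst (Z (s c * x))), fst (snd (Z (s c * x)))))"
      proof (rule system_solution_eigenfunction[OF _ g(1) h(1) s[THEN conjunct1] l])
        fix t :: real assume t: "t \<ge> 0"
        have "drift g h t (Z t) + c *\<^sub>R coupling (Z t) = (k / \<phi> T) *\<^sub>R
           (fst (fst (X1 (y c) c)) *\<^sub>R (drift g h t (X2 t c) + c *\<^sub>R coupling (X2 t c)) -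
            fst (fst (X2 (y c) c)) *\<^sub>R (drift g h t (X1 t c) + c *\<^sub>R coupling (X1 t c)))"
          by (simp add: Z_def drift_def coupling_def algebra_simps)
        then show "(Z has_vector_derivative drift g h t (Z t) + c *\<^sub>R coupling (Z t)) (at t within {0..})"
          unfolding Z_def
          by (simp only:) (intro has_vector_derivative_diff dX[OF t] bounded_linear.has_vector_derivative[OF bounded_linear_scaleR_right])
      next
        show "snd (snd (Z 0)) \<noteq> 0"
          using d(2)[OF ce(2)] k phiT by (simp add: Z_def init1 init2)
      qed (use y(4)[OF ce(1)] in \<open>simp_all add: Z_def init1 init2 sl sl'\<close>)
      moreover have "U c = (\<lambda>x. (fst (fst (Z (s c * x))), fst (snd (Z (s c * x)))))"
        by (simp add: fun_eq_iff U_def Z_def Let_def)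
      ultimately show ?thesis by simp
    qed
    show "((\<lambda>m. L2_norm l (\<lambda>x. U m x - U c x)) \<longlongrightarrow> 0) (at c)"
    proof (rule L2_norm_diff_tendsto_0[OF _ _ c])
      have sub: "{-\<epsilon><..<\<epsilon>} \<times> {0..l} \<subseteq> ball 0 \<delta> \<times> {0..l}" using in_e(1) by auto
      show "continuous_on ({-\<epsilon><..<\<epsilon>} \<times> {0..l}) (\<lambda>z. U (fst z) (snd z))"
        unfolding U_def s_def Let_def
        by (intro continuous_intros cX1' cX2' cy0[OF sub]) (use l phiT in auto)
    qed simp
  qed
qed

section \<open>Simple kernels and the symmetry between the two operators\<close>

text \<open>
  The operator depends only on the values of the potential on \<open>[0, s l]\<close>.
\<close>

lemma L_op_cong:
  assumes s: "s > 0" "s * l \<le> b" and eq: "\<And>t. t \<in> {0..b} \<Longrightarrow> q t = r t"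
  shows "L_op l q s = L_op l r s"
proof -
  have q: "q (s * x) = r (s * x)" if "x \<in> {0<..<l}" for x
  proof -
    have "s * x \<le> b" using that s by (intro order_trans[OF mult_left_mono s(2)]) auto
    then show ?thesis using that s by (intro eq) auto
  qed
  have "ae_eq l f (\<lambda>x. - u'' x - s\<^sup>2 * q (s * x) * u x) \<longleftrightarrow> ae_eq l f (\<lambda>x. - u'' x - s\<^sup>2 * r (s * x) * u x)" for f u u''
    unfolding ae_eq_def by (rule AE_cong) (simp add: q)
  then show ?thesis unfolding L_op_def by simp
qed

lemma L2_norm_cong: "(\<And>x. x \<in> {0<..<l} \<Longrightarrow> f x = g x) \<Longrightarrow> L2_norm l f = L2_norm l g"
  unfolding L2_norm_def by (intro arg_cong[where f = sqrt] Bochner_Integration.integral_cong) auto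

lemma L_op_uminus:
  assumes u: "(u, f) \<in> L_op l q s" and l: "l > 0" and f: "continuous_on {0..l} f" and q: "continuous_on UNIV q"
  shows "(\<lambda>x. - u x, \<lambda>x. - f x) \<in> L_op l q s"
proof -
  have qs: "continuous_on {0..l} (\<lambda>x. q (s * x))"
    by (auto intro!: continuous_intros continuous_on_compose2[OF q])
  obtain u' where u': "dirichlet_solution l q s f u u'"
    by (rule L_op_imp_dirichlet_solution[OF u l f qs])
  have "dirichlet_solution l q s (\<lambda>x. - f x) (\<lambda>x. - u x) (\<lambda>x. - u' x)"
    unfolding dirichlet_solution_def
  proof (intro conjI ballI)
    fix x assume x: "x \<in> {0..l}"
    show "((\<lambda>x. - u x) has_real_derivative - u' x) (at x within {0..l})"
      using u' x by (auto simp: dirichlet_solution_def intro!: DERIV_minus)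
    have "((\<lambda>x. - u' x) has_real_derivative - (- s\<^sup>2 * q (s * x) * u x - f x)) (at x within {0..l})"
      using u' x by (intro DERIV_minus) (auto simp: dirichlet_solution_def)
    then show "((\<lambda>x. - u' x) has_real_derivative - s\<^sup>2 * q (s * x) * - u x - - f x) (at x within {0..l})"
      by (simp add: add.commute)
  qed (use u' in \<open>auto simp: dirichlet_solution_def\<close>)
  then show ?thesis
    by (rule dirichlet_solution_imp_L_op[OF _ _ qs]) (intro continuous_intros f)
qed

lemma dirichlet_kernel:
  assumes u: "(u, \<lambda>_. 0) \<in> L_op l q s" and l: "l > 0" and s: "s > 0" and q: "continuous_on UNIV q"
    and phi: "\<And>T. solves T q (\<lambda>_. 0) \<phi> \<phi>'" "\<phi> 0 = 0" "\<phi>' 0 = 1"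
  obtains k where "\<And>x. x \<in> {0..l} \<Longrightarrow> u x = k * \<phi> (s * x)" "k * \<phi> (s * l) = 0"
proof -
  have qs: "continuous_on {0..l} (\<lambda>x. q (s * x))"
    by (auto intro!: continuous_intros continuous_on_compose2[OF q])
  obtain u' where u': "dirichlet_solution l q s (\<lambda>_. 0) u u'"
    by (rule L_op_imp_dirichlet_solution[OF u l _ qs]) simp
  have sol: "solves (s * l) q (\<lambda>_. 0) (\<lambda>y. u (y / s)) (\<lambda>y. u' (y / s) / s)"
    using dirichlet_solution_imp_solves[OF u' s] by simp
  have ux: "u x = u' 0 / s * \<phi> (s * x)" if "x \<in> {0..l}" for x
    using solves_multiple(1)[OF sol phi(1) continuous_on_subset[OF q] _ phi(2,3), of "s * x"] that s u'
    by (auto simp: dirichlet_solution_def)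
  show thesis
    by (rule that[OF ux]) (use ux[of l] u' l in \<open>auto simp: dirichlet_solution_def\<close>)
qed

lemma dirichlet_unique:
  assumes u: "(u, f) \<in> L_op l q s" and w: "(w, f) \<in> L_op l q s" and f: "continuous_on {0..l} f"
    and l: "l > 0" and s: "s > 0" and q: "continuous_on UNIV q"
    and phi: "\<And>T. solves T q (\<lambda>_. 0) \<phi> \<phi>'" "\<phi> 0 = 0" "\<phi>' 0 = 1" "\<phi> (s * l) \<noteq> 0"
  shows "ae_eq l u w"
proof (rule ae_eqI)
  fix x assume "x \<in> {0<..<l}"
  then have x: "s * x \<in> {0..s * l}" using s by auto
  have qs: "continuous_on {0..l} (\<lambda>x. q (s * x))"
    by (auto intro!: continuous_intros continuous_on_compose2[OF q])
  obtain u' where u': "dirichlet_solution l q s f u u'"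
    by (rule L_op_imp_dirichlet_solution[OF u l f qs])
  obtain w' where w': "dirichlet_solution l q s f w w'"
    by (rule L_op_imp_dirichlet_solution[OF w l f qs])
  have sol: "solves (s * l) q (\<lambda>_. 0) (\<lambda>y. u (y / s) - 1 * w (y / s)) (\<lambda>y. u' (y / s) / s - 1 * (w' (y / s) / s))"
    by (rule solves_cong[OF solves_diff_scaled[OF dirichlet_solution_imp_solves[OF u' s] dirichlet_solution_imp_solves[OF w' s]]]) simp
  define k where "k = (u' 0 - w' 0) / s"
  have eq: "u (y / s) - w (y / s) = k * \<phi> y" if "y \<in> {0..s * l}" for y
    using solves_multiple(1)[OF sol phi(1) continuous_on_subset[OF q] _ phi(2,3) that] u' w'
    by (simp add: dirichlet_solution_def k_def diff_divide_distrib)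
  have "k = 0" using eq[of "s * l"] u' w' s l phi(4) by (simp add: dirichlet_solution_def)
  then show "u x = w x" using eq[OF x] s by simp
qed

text \<open>
  The components of a kernel element are multiples of \<open>\<phi>(s x)\<close> and \<open>\<psi>(s x)\<close>. If both fundamental
  solutions vanished at \<open>s l\<close>, then \<open>(\<phi>, 0)\<close> and \<open>(0, \<psi>)\<close> would be two independent kernel elements.
\<close>

lemma kernel_dichotomy:
  assumes ker: "ker_line l (N_op l g h s) u0" and l: "l > 0" and s: "s > 0"
    and g: "continuous_on UNIV g" and h: "continuous_on UNIV h"
    and phi: "\<And>T. solves T g (\<lambda>_. 0) \<phi> \<phi>'" "\<phi> 0 = 0" "\<phi>' 0 = 1"
    and psi: "\<And>T. solves T h (\<lambda>_. 0) \<psi> \<psi>'" "\<psi> 0 = 0" "\<psi>' 0 = 1"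
  obtains (minus) k where "\<psi> (s * l) = 0" "\<phi> (s * l) \<noteq> 0" "k \<noteq> 0" "\<And>x. x \<in> {0..l} \<Longrightarrow> u0 x = (0, k * \<psi> (s * x))"
  | (plus) k where "\<phi> (s * l) = 0" "\<psi> (s * l) \<noteq> 0" "k \<noteq> 0" "\<And>x. x \<in> {0..l} \<Longrightarrow> u0 x = (k * \<phi> (s * x), 0)"
proof -
  have u0: "(\<lambda>x. fst (u0 x), \<lambda>_. 0) \<in> L_op l g s" "(\<lambda>x. snd (u0 x), \<lambda>_. 0) \<in> L_op l h s" "\<not> ae_eq l u0 (\<lambda>_. 0)"
    and line: "\<And>z. z \<in> ker (N_op l g h s) \<Longrightarrow> \<exists>c. ae_eq l z (\<lambda>x. c *\<^sub>R u0 x)"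
    using ker by (auto simp: ker_line_def ker_def N_op_iff)
  obtain a where a: "\<And>x. x \<in> {0..l} \<Longrightarrow> fst (u0 x) = a * \<phi> (s * x)" "a * \<phi> (s * l) = 0"
    by (rule dirichlet_kernel[OF u0(1) l s g phi]) blast
  obtain b where b: "\<And>x. x \<in> {0..l} \<Longrightarrow> snd (u0 x) = b * \<psi> (s * x)" "b * \<psi> (s * l) = 0"
    by (rule dirichlet_kernel[OF u0(2) l s h psi]) blast
  have u0_eq: "u0 x = (a * \<phi> (s * x), b * \<psi> (s * x))" if "x \<in> {0..l}" for x
    using a(1)[OF that] b(1)[OF that] by (simp add: prod_eq_iff)
  have ab: "a \<noteq> 0 \<or> b \<noteq> 0"
  proof (rule ccontr)
    assume "\<not> (a \<noteq> 0 \<or> b \<noteq> 0)"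
    then have "ae_eq l u0 (\<lambda>_. 0)" by (intro ae_eqI) (auto simp: u0_eq zero_prod_def)
    then show False using u0(3) by simp
  qed
  have c_phi: "continuous_on {0..l} (\<lambda>x. \<phi> (s * x))" and c_psi: "continuous_on {0..l} (\<lambda>x. \<psi> (s * x))"
    using continuous_on_compose2[OF solves_continuous(1)[OF phi(1)[of "s * l"]], of "{0..l}" "\<lambda>x. s * x"]
      continuous_on_compose2[OF solves_continuous(1)[OF psi(1)[of "s * l"]], of "{0..l}" "\<lambda>x. s * x"] s
    by (auto intro!: continuous_intros)
  have c_u0: "continuous_on {0..l} u0"
    by (rule continuous_on_eq[of _ "\<lambda>x. (a * \<phi> (s * x), b * \<psi> (s * x))"]) (auto simp: u0_eq intro!: continuous_intros c_phi c_psi)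
  have nz: "\<exists>x\<in>{0..l}. f (s * x) \<noteq> 0" if f: "solves (s * l) q (\<lambda>_. 0) f f'" "f' 0 = 1" for q f f'
  proof (rule ccontr)
    assume "\<not> ?thesis"
    then have "f (s * x) = 0" if "x \<in> {0..l}" for x using that by blast
    from this[of "y / s" for y] have z: "f y = 0" if "y \<in> {0..s * l}" for y
      using that s by (simp add: field_simps)
    have "(f has_real_derivative f' 0) (at 0 within {0..s * l})"
      using f(1)[unfolded solves_def, THEN bspec, of 0] s l by simp
    then have "f' 0 = 0"
      by (rule has_real_derivative_zero_on_Icc) (use s l z in auto)
    then show False using f by simp
  qed
  obtain x1 where x1: "x1 \<in> {0..l}" "\<phi> (s * x1) \<noteq> 0" using nz[OF phi(1,3)] by blast
  obtain x2 where x2: "x2 \<in> {0..l}" "\<psi> (s * x2) \<noteq> 0" using nz[OF psi(1,3)] by blast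
  have gs: "continuous_on {0..l} (\<lambda>x. g (s * x))" and hs: "continuous_on {0..l} (\<lambda>x. h (s * x))"
    by (auto intro!: continuous_intros continuous_on_compose2[OF g] continuous_on_compose2[OF h])
  have zeroL: "((\<lambda>_. 0), (\<lambda>_. 0)) \<in> L_op l q s" if "continuous_on {0..l} (\<lambda>x. q (s * x))" for q
    by (rule dirichlet_solution_imp_L_op[of _ _ _ _ _ "\<lambda>_. 0"]) (use that in \<open>auto simp: dirichlet_solution_def\<close>)
  have not_both: "\<not> (\<phi> (s * l) = 0 \<and> \<psi> (s * l) = 0)"
  proof
    assume both: "\<phi> (s * l) = 0 \<and> \<psi> (s * l) = 0"
    have L1: "(\<lambda>x. \<phi> (s * x), \<lambda>_. 0) \<in> L_op l g s"
      using solves_imp_dirichlet_solution[OF phi(1) s order_refl phi(2)] both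
      by (intro dirichlet_solution_imp_L_op[OF _ _ gs]) auto
    have L2: "(\<lambda>x. \<psi> (s * x), \<lambda>_. 0) \<in> L_op l h s"
      using solves_imp_dirichlet_solution[OF psi(1) s order_refl psi(2)] both
      by (intro dirichlet_solution_imp_L_op[OF _ _ hs]) auto
    have "(\<lambda>x. (\<phi> (s * x), 0)) \<in> ker (N_op l g h s)" "(\<lambda>x. (0, \<psi> (s * x))) \<in> ker (N_op l g h s)"
      using L1 L2 zeroL[OF gs] zeroL[OF hs] by (simp_all add: ker_def N_op_iff)
    then obtain c1 c2 where c: "ae_eq l (\<lambda>x. (\<phi> (s * x), 0)) (\<lambda>x. c1 *\<^sub>R u0 x)" "ae_eq l (\<lambda>x. (0, \<psi> (s * x))) (\<lambda>x. c2 *\<^sub>R u0 x)"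
      using line by blast
    have e1: "(\<phi> (s * x), 0) = c1 *\<^sub>R u0 x" if "x \<in> {0..l}" for x
      by (rule ae_eq_continuous[OF c(1) _ _ l that]) (intro continuous_intros c_phi c_u0)+
    have e2: "(0, \<psi> (s * x)) = c2 *\<^sub>R u0 x" if "x \<in> {0..l}" for x
      by (rule ae_eq_continuous[OF c(2) _ _ l that]) (intro continuous_intros c_psi c_u0)+
    show False
      using e1[OF x1(1)] e1[OF x2(1)] e2[OF x1(1)] e2[OF x2(1)] x1 x2 by (auto simp: u0_eq)
  qed
  show thesis
  proof (cases "b = 0")
    case True
    then show thesis using ab a b not_both u0_eq by (intro plus[of a]) auto
  next
    case False
    then show thesis using ab a b not_both u0_eq by (intro minus[of b]) auto
  qed
qed

lemma eigenfunction_zero_iff: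
  "eigenfunction l (L_op l q s) 0 u \<longleftrightarrow> (u, \<lambda>_. 0) \<in> L_op l q s \<and> \<not> ae_eq l u (\<lambda>_. 0)"
  by (simp add: eigenfunction_def)

lemma no_kernel:
  assumes "(u, \<lambda>_. 0) \<in> L_op l q s" "l > 0" "s > 0" "continuous_on UNIV q"
    and "\<And>T. solves T q (\<lambda>_. 0) \<phi> \<phi>'" "\<phi> 0 = 0" "\<phi>' 0 = 1" "\<phi> (s * l) \<noteq> 0"
  shows "ae_eq l u (\<lambda>_. 0)"
proof -
  obtain k where "\<And>x. x \<in> {0..l} \<Longrightarrow> u x = k * \<phi> (s * x)" "k * \<phi> (s * l) = 0"
    by (rule dirichlet_kernel[OF assms(1-7)]) blast
  then show ?thesis using assms(8) by (intro ae_eqI) auto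
qed

text \<open>
  If \<open>(u, v)\<close> is an eigenfunction for the potentials \<open>h, g\<close>, then \<open>(- v, u)\<close> is one for \<open>g, h\<close> with
  the same eigenvalue.
\<close>

lemma eigenfunction_swap:
  assumes U: "eigenfunction l (N_op l h g s) c U" and l: "l > 0"
    and g: "continuous_on UNIV g" and h: "continuous_on UNIV h"
  shows "eigenfunction l (N_op l g h s) c (\<lambda>x. (- snd (U x), fst (U x)))"
proof -
  have N: "(\<lambda>x. fst (U x), \<lambda>x. c * snd (U x)) \<in> L_op l h s" "(\<lambda>x. snd (U x), \<lambda>x. - (c * fst (U x))) \<in> L_op l g s"
    and nz: "\<not> ae_eq l U (\<lambda>_. 0)"
    using U by (auto simp: eigenfunction_def N_op_iff)
  have "continuous_on {0..l} (\<lambda>x. fst (U x))" by (rule L_op_continuous[OF N(1) l])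
  then have "continuous_on {0..l} (\<lambda>x. - (c * fst (U x)))"
    by (intro continuous_on_minus continuous_on_mult_left)
  from L_op_uminus[OF N(2) l this g]
  have "(\<lambda>x. - snd (U x), \<lambda>x. c * fst (U x)) \<in> L_op l g s" by simp
  moreover have "\<not> ae_eq l (\<lambda>x. (- snd (U x), fst (U x))) (\<lambda>_. 0)"
    using nz by (simp add: ae_eq_def zero_prod_def prod_eq_iff conj_commute)
  ultimately show ?thesis
    using N(1) by (simp add: eigenfunction_def N_op_iff)
qed

text \<open>
  Both cases of the dichotomy are covered by \<open>eigenvalue_curve\<close>, the second one after the exchange of \<open>g\<close> and
  \<open>h\<close>. In each case one of the two concavity statements is void, because its operator
  has a trivial kernel. In the second case the function \<open>w\<close> of the formula is \<open>- v_hat\<close>.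
\<close>

lemma eigenvalue_curve_of_simple_kernel:
  fixes g h :: "real \<Rightarrow> real" and u0 :: "real \<Rightarrow> real \<times> real"
  assumes l: "l > 0" and s0: "s0 > 0" and b: "s0 * l < b"
    and g: "continuous_on UNIV g" "\<And>t. \<bar>g t\<bar> \<le> M" and h: "continuous_on UNIV h" "\<And>t. \<bar>h t\<bar> \<le> M"
    and ker: "ker_line l (N_op l g h s0) u0"
  obtains \<epsilon> s U where "\<epsilon> > 0" "C2_on {-\<epsilon><..<\<epsilon>} s"
    "\<And>c. c \<in> {-\<epsilon><..<\<epsilon>} \<Longrightarrow> 0 < s c \<and> s c * l < b"
    "\<And>c. c \<in> {-\<epsilon><..<\<epsilon>} \<Longrightarrow> eigenfunction l (N_op l g h (s c)) ((s c)\<^sup>2 * c) (U c)"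
    "\<And>c. c \<in> {-\<epsilon><..<\<epsilon>} \<Longrightarrow> ((\<lambda>m. L2_norm l (\<lambda>x. U m x - U c x)) \<longlongrightarrow> 0) (at c)"
    "\<And>x. x \<in> {0..l} \<Longrightarrow> U 0 x = u0 x"
    "s 0 = s0" "deriv s 0 = 0"
    "\<And>v. 0 \<in> Spec l (L_op l h s0) - Spec l (L_op l g s0) \<Longrightarrow> eigenfunction l (L_op l h s0) 0 v \<Longrightarrow>
       \<exists>u_hat. (u_hat, v) \<in> L_op l g s0 \<and> (\<forall>w. (w, v) \<in> L_op l g s0 \<longrightarrow> ae_eq l w u_hat) \<and>
         deriv_end l v \<noteq> 0 \<and> deriv (deriv s) 0 = 2 * s0 ^ 5 / l * (L2_inner l u_hat v / (deriv_end l v)\<^sup>2)"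
    "\<And>u. 0 \<in> Spec l (L_op l g s0) - Spec l (L_op l h s0) \<Longrightarrow> eigenfunction l (L_op l g s0) 0 u \<Longrightarrow>
       \<exists>v_hat. (v_hat, \<lambda>x. - u x) \<in> L_op l h s0 \<and> (\<forall>w. (w, \<lambda>x. - u x) \<in> L_op l h s0 \<longrightarrow> ae_eq l w v_hat) \<and>
         deriv_end l u \<noteq> 0 \<and> deriv (deriv s) 0 = - (2 * s0 ^ 5 / l) * (L2_inner l v_hat u / (deriv_end l u)\<^sup>2)"
proof -
  obtain \<phi> \<phi>' where phi: "\<And>T. solves T g (\<lambda>_. 0) \<phi> \<phi>'" "\<phi> 0 = 0" "\<phi>' 0 = 1"
    by (rule fundamental_solution_exists[OF g]) blast
  obtain \<psi> \<psi>' where psi: "\<And>T. solves T h (\<lambda>_. 0) \<psi> \<psi>'" "\<psi> 0 = 0" "\<psi>' 0 = 1"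
    by (rule fundamental_solution_exists[OF h]) blast
  show thesis
  proof (cases rule: kernel_dichotomy[OF ker l s0 g(1) h(1) phi psi, case_names minus plus])
    case (minus k)
    obtain \<epsilon> s U where C: "\<epsilon> > 0" "C2_on {-\<epsilon><..<\<epsilon>} s"
      "\<And>c. c \<in> {-\<epsilon><..<\<epsilon>} \<Longrightarrow> 0 < s c \<and> s c * l < b"
      "\<And>c. c \<in> {-\<epsilon><..<\<epsilon>} \<Longrightarrow> eigenfunction l (N_op l g h (s c)) ((s c)\<^sup>2 * c) (U c)"
      "\<And>c. c \<in> {-\<epsilon><..<\<epsilon>} \<Longrightarrow> ((\<lambda>m. L2_norm l (\<lambda>x. U m x - U c x)) \<longlongrightarrow> 0) (at c)"
      "\<And>x. x \<in> {0..l} \<Longrightarrow> U 0 x = (0, k * \<psi> (s0 * x))"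
      "s 0 = s0" "deriv s 0 = 0"
      "\<And>v w. (v, \<lambda>_. 0) \<in> L_op l h s0 \<Longrightarrow> \<not> ae_eq l v (\<lambda>_. 0) \<Longrightarrow> (w, v) \<in> L_op l g s0 \<Longrightarrow>
         deriv_end l v \<noteq> 0 \<and> deriv (deriv s) 0 = 2 * s0 ^ 5 / l * (L2_inner l w v / (deriv_end l v)\<^sup>2)"
      by (rule eigenvalue_curve[OF l s0 b g h phi minus(2) psi minus(1,3)]) blast
    show thesis
    proof (rule that[OF C(1-5) _ C(7,8)])
      show "U 0 x = u0 x" if "x \<in> {0..l}" for x using C(6) minus(4) that by simp
      show "\<exists>u_hat. (u_hat, v) \<in> L_op l g s0 \<and> (\<forall>w. (w, v) \<in> L_op l g s0 \<longrightarrow> ae_eq l w u_hat) \<and>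
         deriv_end l v \<noteq> 0 \<and> deriv (deriv s) 0 = 2 * s0 ^ 5 / l * (L2_inner l u_hat v / (deriv_end l v)\<^sup>2)"
        if spec: "0 \<in> Spec l (L_op l h s0) - Spec l (L_op l g s0)" and v: "eigenfunction l (L_op l h s0) 0 v" for v
      proof -
        have v': "(v, \<lambda>_. 0) \<in> L_op l h s0" "\<not> ae_eq l v (\<lambda>_. 0)" using v by (simp_all add: eigenfunction_zero_iff)
        note cv = L_op_continuous[OF v'(1) l]
        obtain u_hat where u: "(u_hat, v) \<in> L_op l g s0"
          by (rule surjective_if_not_in_Spec[of l "L_op l g s0" v]) (use spec continuous_imp_L2[OF cv] in auto)
        then show ?thesis
          using C(9)[OF v' u] dirichlet_unique[OF _ u cv l s0 g(1) phi minus(2)] by blast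
      qed
      show "\<exists>v_hat. (v_hat, \<lambda>x. - u x) \<in> L_op l h s0 \<and> (\<forall>w. (w, \<lambda>x. - u x) \<in> L_op l h s0 \<longrightarrow> ae_eq l w v_hat) \<and>
         deriv_end l u \<noteq> 0 \<and> deriv (deriv s) 0 = - (2 * s0 ^ 5 / l) * (L2_inner l v_hat u / (deriv_end l u)\<^sup>2)"
        if "eigenfunction l (L_op l g s0) 0 u" for u
        using no_kernel[OF _ l s0 g(1) phi minus(2), of u] that by (simp add: eigenfunction_zero_iff)
    qed
  next
    case (plus k)
    then have nk: "- k \<noteq> 0" by simp
    obtain \<epsilon> s U where C: "\<epsilon> > 0" "C2_on {-\<epsilon><..<\<epsilon>} s"
      "\<And>c. c \<in> {-\<epsilon><..<\<epsilon>} \<Longrightarrow> 0 < s c \<and> s c * l < b"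
      "\<And>c. c \<in> {-\<epsilon><..<\<epsilon>} \<Longrightarrow> eigenfunction l (N_op l h g (s c)) ((s c)\<^sup>2 * c) (U c)"
      "\<And>c. c \<in> {-\<epsilon><..<\<epsilon>} \<Longrightarrow> ((\<lambda>m. L2_norm l (\<lambda>x. U m x - U c x)) \<longlongrightarrow> 0) (at c)"
      "\<And>x. x \<in> {0..l} \<Longrightarrow> U 0 x = (0, - k * \<phi> (s0 * x))"
      "s 0 = s0" "deriv s 0 = 0"
      "\<And>v w. (v, \<lambda>_. 0) \<in> L_op l g s0 \<Longrightarrow> \<not> ae_eq l v (\<lambda>_. 0) \<Longrightarrow> (w, v) \<in> L_op l h s0 \<Longrightarrow>
         deriv_end l v \<noteq> 0 \<and> deriv (deriv s) 0 = 2 * s0 ^ 5 / l * (L2_inner l w v / (deriv_end l v)\<^sup>2)"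
      by (rule eigenvalue_curve[OF l s0 b h g psi plus(2) phi plus(1) nk]) blast
    show thesis
    proof (rule that[of \<epsilon> s "\<lambda>c x. (- snd (U c x), fst (U c x))", OF C(1-3) _ _ _ C(7,8)])
      fix c assume c: "c \<in> {-\<epsilon><..<\<epsilon>}"
      show "eigenfunction l (N_op l g h (s c)) ((s c)\<^sup>2 * c) (\<lambda>x. (- snd (U c x), fst (U c x)))"
        by (rule eigenfunction_swap[OF C(4)[OF c] l g(1) h(1)])
      have "norm ((- snd p, fst p) - (- snd r, fst r)) = norm (p - r)" for p r :: "real \<times> real"
        by (simp add: norm_prod_def power2_commute add.commute)
      then show "((\<lambda>m. L2_norm l (\<lambda>x. (- snd (U m x), fst (U m x)) - (- snd (U c x), fst (U c x)))) \<longlongrightarrow> 0) (at c)"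
        using C(5)[OF c] by (simp only: L2_norm_def)
    next
      show "(- snd (U 0 x), fst (U 0 x)) = u0 x" if "x \<in> {0..l}" for x using C(6) plus(4) that by simp
      show "\<exists>u_hat. (u_hat, v) \<in> L_op l g s0 \<and> (\<forall>w. (w, v) \<in> L_op l g s0 \<longrightarrow> ae_eq l w u_hat) \<and>
         deriv_end l v \<noteq> 0 \<and> deriv (deriv s) 0 = 2 * s0 ^ 5 / l * (L2_inner l u_hat v / (deriv_end l v)\<^sup>2)"
        if "eigenfunction l (L_op l h s0) 0 v" for v
        using no_kernel[OF _ l s0 h(1) psi plus(2), of v] that by (simp add: eigenfunction_zero_iff)
      show "\<exists>v_hat. (v_hat, \<lambda>x. - u x) \<in> L_op l h s0 \<and> (\<forall>w. (w, \<lambda>x. - u x) \<in> L_op l h s0 \<longrightarrow> ae_eq l w v_hat) \<and>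
         deriv_end l u \<noteq> 0 \<and> deriv (deriv s) 0 = - (2 * s0 ^ 5 / l) * (L2_inner l v_hat u / (deriv_end l u)\<^sup>2)"
        if spec: "0 \<in> Spec l (L_op l g s0) - Spec l (L_op l h s0)" and u: "eigenfunction l (L_op l g s0) 0 u" for u
      proof -
        have u': "(u, \<lambda>_. 0) \<in> L_op l g s0" "\<not> ae_eq l u (\<lambda>_. 0)" using u by (simp_all add: eigenfunction_zero_iff)
        have cu: "continuous_on {0..l} (\<lambda>x. - u x)"
          by (intro continuous_intros L_op_continuous[OF u'(1) l])
        obtain v_hat where v: "(v_hat, \<lambda>x. - u x) \<in> L_op l h s0"
          by (rule surjective_if_not_in_Spec[of l "L_op l h s0" "\<lambda>x. - u x"]) (use spec continuous_imp_L2[OF cu] in auto)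
        have neg: "(\<lambda>x. - v_hat x, u) \<in> L_op l h s0"
          using L_op_uminus[OF v l cu h(1)] by simp
        have "L2_inner l (\<lambda>x. - v_hat x) u = - L2_inner l v_hat u"
          by (simp add: L2_inner_def)
        then show ?thesis
          using C(9)[OF u' neg] v dirichlet_unique[OF _ v cu l s0 h(1) psi plus(2)] by auto
      qed
    qed
  qed
qed

section \<open>Coefficients given on an interval only\<close>

lemma C2_on_continuous: "C2_on S f \<Longrightarrow> continuous_on S f"
  unfolding C2_on_def by (meson DERIV_continuous_on)

theorem theorem4p5:
  fixes l l' s0 :: real
    and g h :: "real \<Rightarrow> real"
    and u0 :: "real \<Rightarrow> real \<times> real"
  assumes "l > 0"
    and "l \<le> l'"
    and "s0 = 1 \<Longrightarrow> l < l'"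
    and "C2_on {0..l'} g"
    and "C2_on {0..l'} h"
    and "0 < s0" "s0 \<le> 1"
    and "ker_line l (N_op l g h s0) u0"
  shows "\<exists>\<epsilon>>0. \<exists>(s :: real \<Rightarrow> real) (U :: real \<Rightarrow> real \<Rightarrow> real \<times> real).
     C2_on {-\<epsilon><..<\<epsilon>} s \<and>
     (\<forall>lam\<in>{-\<epsilon><..<\<epsilon>}.
        0 < s lam \<and> s lam * l \<le> l' \<and>
        (s lam)\<^sup>2 * lam \<in> Spec l (N_op l g h (s lam)) \<and>
        eigenfunction l (N_op l g h (s lam)) ((s lam)\<^sup>2 * lam) (U lam) \<and>
        ((\<lambda>mu. L2_norm l (\<lambda>x. U mu x - U lam x)) \<longlongrightarrow> 0) (at lam)) \<and>
     ((\<lambda>lam. L2_norm l (\<lambda>x. U lam x - u0 x)) \<longlongrightarrow> 0) (at 0) \<and>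
     s 0 = s0 \<and>
     deriv s 0 = 0 \<and>
     (\<forall>v. 0 \<in> Spec l (L_op l h s0) - Spec l (L_op l g s0) \<longrightarrow>
          eigenfunction l (L_op l h s0) 0 v \<longrightarrow>
          (\<exists>u_hat. (u_hat, v) \<in> L_op l g s0 \<and>
             (\<forall>w. (w, v) \<in> L_op l g s0 \<longrightarrow> ae_eq l w u_hat) \<and>
             deriv_end l v \<noteq> 0 \<and>
             deriv (deriv s) 0 =
               2 * s0 ^ 5 / l * (L2_inner l u_hat v / (deriv_end l v)\<^sup>2))) \<and>
     (\<forall>u. 0 \<in> Spec l (L_op l g s0) - Spec l (L_op l h s0) \<longrightarrow>
          eigenfunction l (L_op l g s0) 0 u \<longrightarrow>
          (\<exists>v_hat. (v_hat, \<lambda>x. - u x) \<in> L_op l h s0 \<and>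
             (\<forall>w. (w, \<lambda>x. - u x) \<in> L_op l h s0 \<longrightarrow> ae_eq l w v_hat) \<and>
             deriv_end l u \<noteq> 0 \<and>
             deriv (deriv s) 0 =
               - (2 * s0 ^ 5 / l) * (L2_inner l v_hat u / (deriv_end l u)\<^sup>2)))"
proof -
  have cont: "continuous_on {0..l'} g" "continuous_on {0..l'} h"
    using assms(4,5) by (simp_all add: C2_on_continuous)
  \<comment> \<open>Extending the coefficients by their boundary values makes them bounded and continuous on the line.\<close>
  define clip where "clip t = max 0 (min l' t)" for t :: real
  have clip: "continuous_on UNIV clip" "clip t \<in> {0..l'}" for t
    using assms(1,2) unfolding clip_def[abs_def] by (auto intro!: continuous_intros)
  have clip_id: "clip t = t" if "t \<in> {0..l'}" for t using that by (auto simp: clip_def)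
  define G H where "G t = g (clip t)" and "H t = h (clip t)" for t
  have cG: "continuous_on UNIV G" and cH: "continuous_on UNIV H"
    unfolding G_def H_def
    by (rule continuous_on_compose2[OF cont(1) clip(1)] continuous_on_compose2[OF cont(2) clip(1)], use clip(2) in blast)+
  have "bounded (g ` {0..l'} \<union> h ` {0..l'})"
    by (intro bounded_Un[THEN iffD2] conjI compact_imp_bounded compact_continuous_image cont) auto
  then obtain M where "\<forall>x\<in>g ` {0..l'} \<union> h ` {0..l'}. norm x \<le> M" unfolding bounded_iff by blast
  then have M: "\<bar>G t\<bar> \<le> M" "\<bar>H t\<bar> \<le> M" for t
    using clip(2)[of t] by (auto simp: G_def H_def)
  have Lop: "L_op l g r = L_op l G r" "L_op l h r = L_op l H r" if "0 < r" "r * l \<le> l'" for r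
    by (rule L_op_cong[OF that]; simp add: G_def H_def clip_id)+
  have Nop: "N_op l g h r = N_op l G H r" if "0 < r" "r * l \<le> l'" for r
    unfolding N_op_def Lop[OF that] ..
  \<comment> \<open>This is the room to the right of s0 l that the curve needs; for s0 = 1 it comes from l < l'.\<close>
  have b: "s0 * l < l'"
  proof (cases "s0 = 1")
    case False
    then have "s0 * l < 1 * l" using assms(1,7) by (intro mult_strict_right_mono) auto
    then show ?thesis using assms(2) by simp
  qed (use assms(3) in simp)
  have ker: "ker_line l (N_op l G H s0) u0"
    using assms(8) Nop[OF assms(6) less_imp_le[OF b]] by simp
  obtain \<epsilon> s U where C: "\<epsilon> > 0" "C2_on {-\<epsilon><..<\<epsilon>} s"
    "\<And>c. c \<in> {-\<epsilon><..<\<epsilon>} \<Longrightarrow> 0 < s c \<and> s c * l < l'"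
    "\<And>c. c \<in> {-\<epsilon><..<\<epsilon>} \<Longrightarrow> eigenfunction l (N_op l G H (s c)) ((s c)\<^sup>2 * c) (U c)"
    "\<And>c. c \<in> {-\<epsilon><..<\<epsilon>} \<Longrightarrow> ((\<lambda>m. L2_norm l (\<lambda>x. U m x - U c x)) \<longlongrightarrow> 0) (at c)"
    "\<And>x. x \<in> {0..l} \<Longrightarrow> U 0 x = u0 x"
    "s 0 = s0" "deriv s 0 = 0"
    "\<And>v. 0 \<in> Spec l (L_op l H s0) - Spec l (L_op l G s0) \<Longrightarrow> eigenfunction l (L_op l H s0) 0 v \<Longrightarrow>
       \<exists>u_hat. (u_hat, v) \<in> L_op l G s0 \<and> (\<forall>w. (w, v) \<in> L_op l G s0 \<longrightarrow> ae_eq l w u_hat) \<and>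
         deriv_end l v \<noteq> 0 \<and> deriv (deriv s) 0 = 2 * s0 ^ 5 / l * (L2_inner l u_hat v / (deriv_end l v)\<^sup>2)"
    "\<And>u. 0 \<in> Spec l (L_op l G s0) - Spec l (L_op l H s0) \<Longrightarrow> eigenfunction l (L_op l G s0) 0 u \<Longrightarrow>
       \<exists>v_hat. (v_hat, \<lambda>x. - u x) \<in> L_op l H s0 \<and> (\<forall>w. (w, \<lambda>x. - u x) \<in> L_op l H s0 \<longrightarrow> ae_eq l w v_hat) \<and>
         deriv_end l u \<noteq> 0 \<and> deriv (deriv s) 0 = - (2 * s0 ^ 5 / l) * (L2_inner l v_hat u / (deriv_end l u)\<^sup>2)"
    by (rule eigenvalue_curve_of_simple_kernel[OF assms(1,6) b cG M(1) cH M(2) ker]) blast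
  have eig: "eigenfunction l (N_op l g h (s c)) ((s c)\<^sup>2 * c) (U c)" if "c \<in> {-\<epsilon><..<\<epsilon>}" for c
    using C(3,4)[OF that] Nop[of "s c"] by simp
  have "L2_norm l (\<lambda>x. U c x - u0 x) = L2_norm l (\<lambda>x. U c x - U 0 x)" for c
    by (rule L2_norm_cong) (simp add: C(6))
  then have lim0: "((\<lambda>c. L2_norm l (\<lambda>x. U c x - u0 x)) \<longlongrightarrow> 0) (at 0)"
    using C(5)[of 0] C(1) by simp
  show ?thesis
    unfolding Lop[OF assms(6) less_imp_le[OF b]]
  proof (rule exI[of _ \<epsilon>], intro conjI, rule C(1), rule exI[of _ s], rule exI[of _ U], intro conjI ballI)
    fix c assume c: "c \<in> {-\<epsilon><..<\<epsilon>}"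
    show "0 < s c" "s c * l \<le> l'" using C(3)[OF c] by auto
    show "(s c)\<^sup>2 * c \<in> Spec l (N_op l g h (s c))" by (rule eigenvalue_in_Spec[OF eig[OF c]])
    show "eigenfunction l (N_op l g h (s c)) ((s c)\<^sup>2 * c) (U c)" by (rule eig[OF c])
    show "((\<lambda>m. L2_norm l (\<lambda>x. U m x - U c x)) \<longlongrightarrow> 0) (at c)" by (rule C(5)[OF c])
  qed (use C lim0 in blast)+
qed

end
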